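(* Let an instance of the single drone delivery scheduling problem (SDSP) be given, with $n$ deliveries. For every $\epsilon>0$ there is an algorithm that computes a feasible set $S'$ of deliveries with $\mathcal{P}(S')\ge (1-\epsilon)\,f(1)$, where $f(1)$ is the optimum value of the instance, and whose running time is $\mathcal{O}(n^{2}\lfloor n/\epsilon\rfloor)$. In other words, SDSP admits a fully polynomial time approximation scheme (FPTAS) with this running time.
   Context: An SDSP instance consists of a set of deliveries $\mathcal{N}=\{1,\dots,n\}$ and one drone with battery budget $B>0$. Each delivery $j$ has a delivery time interval $I_j=[t_j^L,t_j^R]$ (closed, $t_j^L\le t_j^R$), a cost $c_j>0$ and a profit $p_j\ge 0$. Two deliveries $j\neq k$ are compatible if $I_j\cap I_k=\emptyset$, otherwise conflicting. A set $S\subseteq\mathcal{N}$ is compatible if its elements are pairwise compatible, and feasible if it is compatible and its cost $\mathcal{W}(S)=\sum_{j\in S}c_j\le B$. Its profit is $\mathcal{P}(S)=\sum_{j\in S}p_j$. SDSP asks for a feasible set of maximum profit; this maximum is denoted $f(1)$. *)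

theory Defs
  imports Complex_Main
begin

section \<open>The single drone delivery scheduling problem\<close>

text \<open>
  The deliveries of an instance are \<open>1, \<dots>, num I\<close>; the data at other indices are irrelevant.
\<close>

record sdsp =
  num :: nat
  budget :: real
  tL :: "nat \<Rightarrow> real"
  tR :: "nat \<Rightarrow> real"
  cost :: "nat \<Rightarrow> real"
  profit :: "nat \<Rightarrow> real"

definition sdsp_instance :: "sdsp \<Rightarrow> bool" where
  "sdsp_instance I \<longleftrightarrow> budget I > 0 \<and>
     (\<forall>j\<in>{1..num I}. tL I j \<le> tR I j \<and> cost I j > 0 \<and> profit I j \<ge> 0)"

definition interval :: "sdsp \<Rightarrow> nat \<Rightarrow> real set" where
  "interval I j = {tL I j..tR I j}"

definition compatible_set :: "sdsp \<Rightarrow> nat set \<Rightarrow> bool" where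
  "compatible_set I S \<longleftrightarrow> pairwise (\<lambda>j k. interval I j \<inter> interval I k = {}) S"

definition total_cost :: "sdsp \<Rightarrow> nat set \<Rightarrow> real" where
  "total_cost I S = (\<Sum>j\<in>S. cost I j)"

definition total_profit :: "sdsp \<Rightarrow> nat set \<Rightarrow> real" where
  "total_profit I S = (\<Sum>j\<in>S. profit I j)"

definition feasible :: "sdsp \<Rightarrow> nat set \<Rightarrow> bool" where
  "feasible I S \<longleftrightarrow> S \<subseteq> {1..num I} \<and> compatible_set I S \<and> total_cost I S \<le> budget I"

definition opt :: "sdsp \<Rightarrow> real" where
  "opt I = Max (total_profit I ` {S. feasible I S})"


section \<open>Random access machine\<close>

text \<open>
  Algorithms are programs of a structured random access machine over two sorts of data: natural
  numbers, used for counting and addressing, and reals, used for the data of the instance. As in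
  the machine of Cook and Reckhow, the only arithmetic operations are addition and subtraction
  (truncated on \<open>nat\<close>); there is neither multiplication, nor division, nor rounding, so charging
  one unit per operation does not hide expensive arithmetic. Reals can only be added, subtracted
  and compared; in particular they cannot be turned into addresses. The constants are natural
  numbers, so that a program cannot contain the answer to a problem encoded in a real.

  The memory consists of named arrays, unbounded and indexed from 0; a scalar variable is an array
  of which only the cell 0 is used.
\<close>

record mem =
  nmem :: "string \<Rightarrow> nat \<Rightarrow> nat"
  rmem :: "string \<Rightarrow> nat \<Rightarrow> real"

datatype nexp = NConst nat | NGet string nexp | NAdd nexp nexp | NSub nexp nexp

datatype rexp = RConst nat | RGet string nexp | RAdd rexp rexp | RSub rexp rexp

datatype bexp = NLess nexp nexp | RLess rexp rexp | BNot bexp | BAnd bexp bexp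

datatype com =
    Skip
  | NPut string nexp nexp  \<comment> \<open>array, index, new content\<close>
  | RPut string nexp rexp
  | Then com com
  | Cond bexp com com
  | Loop bexp com

primrec nval :: "nexp \<Rightarrow> mem \<Rightarrow> nat" where
  "nval (NConst k) s = k"
| "nval (NGet x i) s = nmem s x (nval i s)"
| "nval (NAdd a b) s = nval a s + nval b s"
| "nval (NSub a b) s = nval a s - nval b s"

primrec rval :: "rexp \<Rightarrow> mem \<Rightarrow> real" where
  "rval (RConst k) s = real k"
| "rval (RGet x i) s = rmem s x (nval i s)"
| "rval (RAdd a b) s = rval a s + rval b s"
| "rval (RSub a b) s = rval a s - rval b s"

primrec bval :: "bexp \<Rightarrow> mem \<Rightarrow> bool" where
  "bval (NLess a b) s \<longleftrightarrow> nval a s < nval b s"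
| "bval (RLess a b) s \<longleftrightarrow> rval a s < rval b s"
| "bval (BNot b) s \<longleftrightarrow> \<not> bval b s"
| "bval (BAnd a b) s \<longleftrightarrow> bval a s \<and> bval b s"

text \<open>The time to evaluate an expression is its number of nodes.\<close>

primrec ntime :: "nexp \<Rightarrow> nat" where
  "ntime (NConst k) = 1"
| "ntime (NGet x i) = 1 + ntime i"
| "ntime (NAdd a b) = 1 + ntime a + ntime b"
| "ntime (NSub a b) = 1 + ntime a + ntime b"

primrec rtime :: "rexp \<Rightarrow> nat" where
  "rtime (RConst k) = 1"
| "rtime (RGet x i) = 1 + ntime i"
| "rtime (RAdd a b) = 1 + rtime a + rtime b"
| "rtime (RSub a b) = 1 + rtime a + rtime b"

primrec btime :: "bexp \<Rightarrow> nat" where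
  "btime (NLess a b) = 1 + ntime a + ntime b"
| "btime (RLess a b) = 1 + rtime a + rtime b"
| "btime (BNot b) = 1 + btime b"
| "btime (BAnd a b) = 1 + btime a + btime b"

definition nput :: "string \<Rightarrow> nat \<Rightarrow> nat \<Rightarrow> mem \<Rightarrow> mem" where
  "nput x i v s = s\<lparr>nmem := (nmem s)(x := (nmem s x)(i := v))\<rparr>"

definition rput :: "string \<Rightarrow> nat \<Rightarrow> real \<Rightarrow> mem \<Rightarrow> mem" where
  "rput x i v s = s\<lparr>rmem := (rmem s)(x := (rmem s x)(i := v))\<rparr>"

text \<open>
  \<open>exec c s t s'\<close>: started in memory \<open>s\<close>, the program \<open>c\<close> halts after time \<open>t\<close> in memory \<open>s'\<close>.
\<close>

inductive exec :: "com \<Rightarrow> mem \<Rightarrow> nat \<Rightarrow> mem \<Rightarrow> bool" where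
  Skip: "exec Skip s 1 s"
| NPut: "exec (NPut x i a) s (1 + ntime i + ntime a) (nput x (nval i s) (nval a s) s)"
| RPut: "exec (RPut x i a) s (1 + ntime i + rtime a) (rput x (nval i s) (rval a s) s)"
| Then: "exec c s t s' \<Longrightarrow> exec d s' u s'' \<Longrightarrow> exec (Then c d) s (t + u) s''"
| CondTrue: "bval b s \<Longrightarrow> exec c s t s' \<Longrightarrow> exec (Cond b c d) s (1 + btime b + t) s'"
| CondFalse: "\<not> bval b s \<Longrightarrow> exec d s t s' \<Longrightarrow> exec (Cond b c d) s (1 + btime b + t) s'"
| LoopFalse: "\<not> bval b s \<Longrightarrow> exec (Loop b c) s (1 + btime b) s"
| LoopTrue: "bval b s \<Longrightarrow> exec c s t s' \<Longrightarrow> exec (Loop b c) s' u s'' \<Longrightarrow>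
    exec (Loop b c) s (1 + btime b + t + u) s''"

inductive_cases exec_SkipE: "exec Skip s t s'"
inductive_cases exec_NPutE: "exec (NPut x i a) s t s'"
inductive_cases exec_RPutE: "exec (RPut x i a) s t s'"
inductive_cases exec_ThenE: "exec (Then c d) s t s'"
inductive_cases exec_CondE: "exec (Cond b c d) s t s'"
inductive_cases exec_LoopE: "exec (Loop b c) s t s'"

text \<open>Halting time and final memory are unique, so an existential over them states total
  correctness.\<close>

lemma exec_deterministic:
  assumes "exec c s t s'" "exec c s u s''"
  shows "u = t \<and> s'' = s'"
  using assms
proof (induction arbitrary: u s'' rule: exec.induct)
  case (Skip s)
  then show ?case by (auto elim: exec_SkipE)
next
  case (NPut x i a s)
  then show ?case by (auto elim: exec_NPutE)
next
  case (RPut x i a s)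
  then show ?case by (auto elim: exec_RPutE)
next
  case (Then c s t s1 d v s2)
  from Then.prems obtain t' m u' where
    m: "exec c s t' m" "exec d m u' s''" "u = t' + u'"
    by (rule exec_ThenE)
  then have "t' = t \<and> m = s1" using Then.IH(1) by simp
  with m Then.IH(2) show ?case by simp
next
  case (CondTrue b s c t s1 d)
  from CondTrue.prems CondTrue.hyps(1) obtain t' where
    "exec c s t' s''" "u = 1 + btime b + t'"
    by (cases rule: exec_CondE) auto
  with CondTrue.IH show ?case by simp
next
  case (CondFalse b s d t s1 c)
  from CondFalse.prems CondFalse.hyps(1) obtain t' where
    "exec d s t' s''" "u = 1 + btime b + t'"
    by (cases rule: exec_CondE) auto
  with CondFalse.IH show ?case by simp
next
  case (LoopFalse b s c)
  from LoopFalse.prems LoopFalse.hyps show ?case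
    by (cases rule: exec_LoopE) auto
next
  case (LoopTrue b s c t s1 v s2)
  from LoopTrue.prems LoopTrue.hyps(1) obtain t' m u' where
    m: "exec c s t' m" "exec (Loop b c) m u' s''" "u = 1 + btime b + t' + u'"
    by (cases rule: exec_LoopE) auto
  then have "t' = t \<and> m = s1" using LoopTrue.IH(1) by simp
  with m LoopTrue.IH(2) show ?case by simp
qed


section \<open>Input and output\<close>

text \<open>
  A program receives the instance and the accuracy in the arrays below; all other cells, in
  particular those beyond index \<open>num I\<close>, are zero. It returns the set of all indices at which the
  array \<open>out\<close> is nonzero.
\<close>

definition input :: "sdsp \<Rightarrow> real \<Rightarrow> mem" where
  "input I \<epsilon> =
    (let row = (\<lambda>f j. if j \<in> {1..num I} then f j else 0);
         scalar = (\<lambda>a j. if j = 0 then a else 0)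
     in \<lparr>nmem = (\<lambda>_ _. 0)(''n'' := (\<lambda>j. if j = 0 then num I else 0)),
         rmem = (\<lambda>_ _. 0)(''eps'' := scalar \<epsilon>, ''B'' := scalar (budget I),
           ''tL'' := row (tL I), ''tR'' := row (tR I),
           ''c'' := row (cost I), ''p'' := row (profit I))\<rparr>)"

definition result :: "mem \<Rightarrow> nat set" where
  "result s = {j. nmem s ''out'' j \<noteq> 0}"

end

theory Submission
  imports Defs
begin

text \<open>
  Let \<open>M\<close> be the largest profit of a delivery that is feasible on its own, and let \<open>N\<close> be the least
  number with \<open>N \<epsilon> > n\<close>. The profits are scaled and rounded to \<open>w\<^sub>j = \<lfloor>N p\<^sub>j / M\<rfloor> \<le> N\<close>, which loses at
  most \<open>n M / N \<le> \<epsilon> f(1)\<close> in total. For integral profits of sum at most \<open>n N\<close>, dynamic programming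
  over the deliveries ordered by right endpoint finds the least cost of a compatible set among the
  first \<open>i\<close> deliveries with scaled profit exactly \<open>q\<close>: the last delivery \<open>j\<close> can only be combined
  with those ending before \<open>t\<^sub>j\<^sup>L\<close>, which form a prefix of the order. The table has
  \<open>(n + 1) (n N + 1)\<close> entries, and a best set is found by walking back through it.

  Using \<open>M / N\<close> instead of the usual scaling factor \<open>\<epsilon> M / n\<close> avoids the product of two reals,
  so that additions and subtractions suffice. For \<open>\<epsilon> \<ge> 1\<close> the empty set is good enough; it must be
  returned at once, since \<open>\<lfloor>n / \<epsilon>\<rfloor>\<close> can be \<open>0\<close>. For \<open>\<epsilon> < 1\<close>, \<open>\<lfloor>n / \<epsilon>\<rfloor> \<ge> n\<close>, so there is time for
  cubic preprocessing.
\<close>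


section \<open>The dynamic program\<close>

text \<open>Ties in the right endpoint are broken by index, which makes ranks distinct;
  \<open>j\<close> itself is counted, so ranks start at 1. Only strict comparisons of endpoints
  occur, because \<open>RLess\<close> is the only test on reals that the machine has.\<close>

definition upto_set :: "sdsp \<Rightarrow> nat \<Rightarrow> nat set" where
  "upto_set I j = {k \<in> {1..num I}. tR I k < tR I j \<or> \<not> tR I j < tR I k \<and> k \<le> j}"

definition rank :: "sdsp \<Rightarrow> nat \<Rightarrow> nat" where
  "rank I j = card (upto_set I j)"

definition npred :: "sdsp \<Rightarrow> nat \<Rightarrow> nat" where
  "npred I j = card {k \<in> {1..num I}. tR I k < tL I j}"

definition item :: "sdsp \<Rightarrow> nat \<Rightarrow> nat" where
  "item I i = inv_into {1..num I} (rank I) i"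

definition prefix :: "sdsp \<Rightarrow> nat \<Rightarrow> nat set" where
  "prefix I i = {k \<in> {1..num I}. rank I k \<le> i}"

text \<open>
  \<open>item I i\<close> is the delivery of rank \<open>i\<close> by right endpoint. Since \<open>npred I (item I i) < i\<close> in
  every instance, the minimum with \<open>i\<close> below is vacuous; it only serves termination. The value
  \<open>budget I + 1\<close> stands for infinity.
\<close>

function mincost :: "sdsp \<Rightarrow> (nat \<Rightarrow> nat) \<Rightarrow> nat \<Rightarrow> nat \<Rightarrow> real" where
  "mincost I w 0 q = (if q = 0 then 0 else budget I + 1)"
| "mincost I w (Suc i) q =
     (let j = item I (Suc i); x = mincost I w i q;
          y = mincost I w (min i (npred I j)) (q - w j) + cost I j
      in if w j \<le> q \<and> y < x then y else x)"
  by pat_completeness auto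
termination by (relation "measure (\<lambda>(I, w, i, q). i)") auto

text \<open>Choices are not stored. In \<open>mincost\<close> a row differs from the previous one in
  column \<open>q\<close> only through a strict decrease, so comparing the two entries reveals
  whether the delivery of rank \<open>Suc i\<close> was taken.\<close>

function trace :: "sdsp \<Rightarrow> (nat \<Rightarrow> nat) \<Rightarrow> nat \<Rightarrow> nat \<Rightarrow> nat set" where
  "trace I w 0 q = {}"
| "trace I w (Suc i) q =
     (let j = item I (Suc i)
      in if mincost I w (Suc i) q < mincost I w i q
         then insert j (trace I w (min i (npred I j)) (q - w j)) else trace I w i q)"
  by pat_completeness auto
termination by (relation "measure (\<lambda>(I, w, i, q). i)") auto

declare mincost.simps(2) [simp del] trace.simps(2) [simp del]

section \<open>Ranks by right endpoint and prefixes of the order\<close>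

lemma finite_upto_set [simp]: "finite (upto_set I j)"
  by (simp add: upto_set_def)

lemma rank_le: "rank I j \<le> num I"
proof -
  have "card (upto_set I j) \<le> card {1..num I}"
    by (intro card_mono) (auto simp: upto_set_def)
  then show ?thesis by (simp add: rank_def)
qed

lemma rank_pos:
  assumes "j \<in> {1..num I}"
  shows "1 \<le> rank I j"
proof -
  have "upto_set I j \<noteq> {}"
    using assms by (auto simp: upto_set_def)
  then have "0 < card (upto_set I j)" by (simp add: card_gt_0_iff)
  then show ?thesis unfolding rank_def by linarith
qed

text \<open>The two sets counted by \<open>rank\<close> are nested, and only the larger one contains
  \<open>j\<close>.\<close>

lemma rank_less:
  assumes "j \<in> {1..num I}" "k \<in> {1..num I}" "tR I k < tR I j \<or> tR I k = tR I j \<and> k < j"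
  shows "rank I k < rank I j"
proof -
  have "upto_set I k \<subseteq> upto_set I j" "j \<in> upto_set I j" "j \<notin> upto_set I k"
    using assms by (auto simp: upto_set_def)
  then have "upto_set I k \<subset> upto_set I j" by blast
  then show ?thesis by (simp add: rank_def psubset_card_mono)
qed

lemma inj_on_rank: "inj_on (rank I) {1..num I}"
proof (rule inj_onI)
  fix j k assume *: "j \<in> {1..num I}" "k \<in> {1..num I}" "rank I j = rank I k"
  show "j = k"
    using rank_less[OF *(1,2)] rank_less[OF *(2,1)] *(3)
    by (cases "tR I j" "tR I k" rule: linorder_cases; cases j k rule: linorder_cases; simp)
qed

text \<open>An injection of a finite set into itself is onto. Hence \<open>item\<close> is a genuine
  inverse of \<open>rank\<close>.\<close>

lemma rank_image: "rank I ` {1..num I} = {1..num I}"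
proof (rule card_subset_eq)
  show "rank I ` {1..num I} \<subseteq> {1..num I}"
  proof
    fix i assume "i \<in> rank I ` {1..num I}"
    then obtain j where "j \<in> {1..num I}" "i = rank I j" by blast
    then show "i \<in> {1..num I}" using rank_le[of I j] rank_pos[of j I] by simp
  qed
  show "card (rank I ` {1..num I}) = card {1..num I}"
    by (rule card_image[OF inj_on_rank])
qed simp

lemma item_in: "i \<in> {1..num I} \<Longrightarrow> item I i \<in> {1..num I}"
  unfolding item_def by (rule inv_into_into) (simp only: rank_image)

lemma rank_item: "i \<in> {1..num I} \<Longrightarrow> rank I (item I i) = i"
  unfolding item_def by (rule f_inv_into_f) (simp only: rank_image)

lemma item_rank: "j \<in> {1..num I} \<Longrightarrow> item I (rank I j) = j"
  unfolding item_def by (rule inv_into_f_f[OF inj_on_rank])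

text \<open>Everything that ends before \<open>j\<close> begins is counted in the rank of
  \<open>j\<close>, and so is \<open>j\<close> itself, whose interval is nonempty. This is why the
  minimum in \<open>mincost\<close> and \<open>trace\<close> always equals
  \<open>npred\<close>.\<close>

lemma npred_less:
  assumes "j \<in> {1..num I}" "tL I j \<le> tR I j"
  shows "npred I j < rank I j"
proof -
  have "{k \<in> {1..num I}. tR I k < tL I j} \<subseteq> upto_set I j" "j \<in> upto_set I j"
    using assms by (auto simp: upto_set_def)
  moreover have "j \<notin> {k \<in> {1..num I}. tR I k < tL I j}" using assms by simp
  ultimately have "{k \<in> {1..num I}. tR I k < tL I j} \<subset> upto_set I j" by blast
  then show ?thesis by (simp add: rank_def npred_def psubset_card_mono)
qed

lemma finite_prefix [simp]: "finite (prefix I i)"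
  by (simp add: prefix_def)

lemma prefix_0 [simp]: "prefix I 0 = {}"
proof -
  have "rank I k \<noteq> 0" if "k \<in> {1..num I}" for k using rank_pos[OF that] by simp
  then show ?thesis by (simp add: prefix_def)
qed

lemma prefix_Suc:
  assumes "Suc i \<in> {1..num I}"
  shows "prefix I (Suc i) = insert (item I (Suc i)) (prefix I i)"
proof (rule set_eqI)
  fix k
  show "k \<in> prefix I (Suc i) \<longleftrightarrow> k \<in> insert (item I (Suc i)) (prefix I i)"
  proof (cases "k \<in> {1..num I} \<and> rank I k = Suc i")
    case True
    then have "k = item I (Suc i)" using item_rank[of k I] by simp
    then show ?thesis using True by (simp add: prefix_def)
  next
    case False
    then have "k \<noteq> item I (Suc i)"
      using item_in[OF assms] rank_item[OF assms] by blast
    then show ?thesis using False by (auto simp: prefix_def le_Suc_eq)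
  qed
qed

lemma prefix_num: "prefix I (num I) = {1..num I}"
  using rank_le by (auto simp: prefix_def)

text \<open>If \<open>k\<close> ends before \<open>j\<close> begins, so does every delivery counted
  in the rank of \<open>k\<close>. If not, the deliveries counted by \<open>npred I j\<close> form a
  proper subset of \<open>upto_set I k\<close>, which also contains \<open>k\<close>. Thus the
  candidates for combination with a last delivery \<open>j\<close> are exactly one row of the
  table.\<close>

lemma prefix_npred: "prefix I (npred I j) = {k \<in> {1..num I}. tR I k < tL I j}"
proof -
  have "rank I k \<le> npred I j \<longleftrightarrow> tR I k < tL I j" if k: "k \<in> {1..num I}" for k
  proof (cases "tR I k < tL I j")
    case True
    then have "upto_set I k \<subseteq> {k \<in> {1..num I}. tR I k < tL I j}"
      by (auto simp: upto_set_def)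
    then show ?thesis
      using True by (simp add: rank_def npred_def card_mono)
  next
    case False
    then have "{k \<in> {1..num I}. tR I k < tL I j} \<subseteq> upto_set I k" "k \<in> upto_set I k"
      using k by (auto simp: upto_set_def)
    then have "{k \<in> {1..num I}. tR I k < tL I j} \<subset> upto_set I k" using False by force
    then show ?thesis
      using False by (simp add: rank_def npred_def not_le psubset_card_mono)
  qed
  then show ?thesis by (auto simp: prefix_def)
qed

section \<open>Correctness of the recurrence and of the walk back\<close>

lemma interval_disjoint:
  assumes "tR I k < tL I j"
  shows "interval I j \<inter> interval I k = {}" "interval I k \<inter> interval I j = {}"
  using assms by (auto simp: interval_def)

text \<open>Induction on the row, by cases on whether the delivery of rank \<open>i\<close> belongs
  to \<open>S\<close>: either \<open>S\<close> already lies in the previous prefix, or the rest of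
  \<open>S\<close> lies in the prefix of length \<open>npred\<close>.\<close>

lemma mincost_le:
  assumes I: "sdsp_instance I"
  shows "i \<le> num I \<Longrightarrow> S \<subseteq> prefix I i \<Longrightarrow> compatible_set I S \<Longrightarrow>
    mincost I w i (sum w S) \<le> total_cost I S"
proof (induction i arbitrary: S rule: less_induct)
  case (less i)
  show ?case
  proof (cases i)
    case 0
    with less.prems show ?thesis by (simp add: total_cost_def)
  next
    case (Suc i')
    define j where "j = item I i"
    have i: "Suc i' \<in> {1..num I}" using Suc less.prems by simp
    have j: "j \<in> {1..num I}" "rank I j = i" using item_in[OF i] rank_item[OF i] Suc by (auto simp: j_def)
    have tj: "tL I j \<le> tR I j" using I j by (auto simp: sdsp_instance_def)
    have np: "npred I j \<le> i'" using npred_less[OF j(1) tj] j Suc by simp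
    show ?thesis
    proof (cases "j \<in> S")
      case False
      then have "S \<subseteq> prefix I i'"
        using less.prems(2) prefix_Suc[OF i] Suc by (auto simp: j_def)
      then have "mincost I w i' (sum w S) \<le> total_cost I S"
        using less Suc by simp
      then show ?thesis
        by (simp add: Suc mincost.simps(2) Let_def)
    next
      case True
      define S' where "S' = S - {j}"
      have fin: "finite S" by (rule finite_subset[OF less.prems(2) finite_prefix])
      have comp: "compatible_set I S'"
        using less.prems(3) by (auto simp: compatible_set_def S'_def pairwise_def)
      have "S' \<subseteq> prefix I (npred I j)"
      proof
        fix k assume k: "k \<in> S'"
        have kp: "k \<in> prefix I i'"
          using k less.prems(2) prefix_Suc[OF i] Suc by (auto simp: j_def S'_def)
        then have kI: "k \<in> {1..num I}" "rank I k \<le> i'" by (auto simp: prefix_def)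
        \<comment> \<open>As \<open>k\<close> has smaller rank it does not end after
          \<open>j\<close>. If it ended at or after \<open>tL I j\<close>, the point
          \<open>tR I k\<close> would lie in both intervals.\<close>
        have "\<not> tR I j < tR I k"
          using rank_less[OF kI(1) j(1)] kI j Suc by auto
        moreover have "interval I j \<inter> interval I k = {}"
          using less.prems(3) True k by (auto simp: compatible_set_def pairwise_def S'_def)
        moreover have "tL I k \<le> tR I k" using I kI by (auto simp: sdsp_instance_def)
        ultimately have "tR I k < tL I j"
          unfolding interval_def by (force simp: disjoint_iff)
        then show "k \<in> prefix I (npred I j)"
          using kI by (simp add: prefix_npred)
      qed
      then have "mincost I w (npred I j) (sum w S') \<le> total_cost I S'"
        using less np Suc comp by simp
      moreover have "total_cost I S = total_cost I S' + cost I j" "sum w S = sum w S' + w j"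
        using True fin by (simp_all add: total_cost_def S'_def sum.remove[of S j])
      ultimately show ?thesis
        using np by (simp add: Suc mincost.simps(2) Let_def j_def[unfolded Suc, symmetric] min_absorb2)
    qed
  qed
qed

text \<open>The walk back attains the table entry. The assumption that the entry is within the
  budget separates attained values from \<open>budget I + 1\<close>, the stand-in for
  infinity.\<close>

lemma trace_correct:
  assumes I: "sdsp_instance I"
  shows "i \<le> num I \<Longrightarrow> mincost I w i q \<le> budget I \<Longrightarrow>
    trace I w i q \<subseteq> prefix I i \<and> compatible_set I (trace I w i q) \<and>
    sum w (trace I w i q) = q \<and> total_cost I (trace I w i q) = mincost I w i q"
proof (induction i arbitrary: q rule: less_induct)
  case (less i)
  show ?case
  proof (cases i)
    case 0
    with less.prems show ?thesis
      by (auto simp: total_cost_def compatible_set_def split: if_splits)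
  next
    case (Suc i')
    define j where "j = item I i"
    have i: "Suc i' \<in> {1..num I}" using Suc less.prems by simp
    have j: "j \<in> {1..num I}" "rank I j = i" using item_in[OF i] rank_item[OF i] Suc by (auto simp: j_def)
    have tj: "tL I j \<le> tR I j" and cj: "cost I j > 0" using I j by (auto simp: sdsp_instance_def)
    have np: "npred I j \<le> i'" using npred_less[OF j(1) tj] j Suc by simp
    note j' = j_def[unfolded Suc, symmetric]
    show ?thesis
    proof (cases "mincost I w i q < mincost I w i' q")
      case False
      \<comment> \<open>Entries of a column never increase with the row, so absence of a strict
        decrease means equality.\<close>
      then have "mincost I w i q = mincost I w i' q"
        by (auto simp: Suc mincost.simps(2) Let_def split: if_splits)
      then show ?thesis
        using less.IH[of i' q] less.prems False prefix_Suc[OF i]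
        by (auto simp: Suc trace.simps(2) Let_def)
    next
      case True
      let ?T = "trace I w (npred I j) (q - w j)"
      have m: "w j \<le> q" "mincost I w i q = mincost I w (npred I j) (q - w j) + cost I j"
        using True np by (auto simp: Suc mincost.simps(2) Let_def j' min_absorb2 split: if_splits)
      have T: "trace I w i q = insert j ?T"
        using True np by (simp add: Suc trace.simps(2) Let_def j' min_absorb2)
      \<comment> \<open>Costs are positive, so the entry to which \<open>cost I j\<close> was added
        is within the budget too, and the induction hypothesis applies.\<close>
      have IH: "?T \<subseteq> prefix I (npred I j)" "compatible_set I ?T" "sum w ?T = q - w j"
         "total_cost I ?T = mincost I w (npred I j) (q - w j)"
        using less.IH[of "npred I j" "q - w j"] less.prems m cj np Suc by auto
      have fin: "finite ?T" by (rule finite_subset[OF IH(1) finite_prefix])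
      have jT: "j \<notin> ?T" using IH(1) tj by (auto simp: prefix_npred)
      have "?T \<subseteq> prefix I i'" using IH(1) np by (auto simp: prefix_def)
      then have 1: "insert j ?T \<subseteq> prefix I i"
        using prefix_Suc[OF i] by (auto simp: Suc j')
      have 2: "compatible_set I (insert j ?T)"
        using IH(1,2) interval_disjoint[of I _ j]
        by (auto simp: compatible_set_def pairwise_insert prefix_npred)
      show ?thesis
        using 1 2 fin jT IH m by (simp add: T total_cost_def)
    qed
  qed
qed

section \<open>The optimum and the loss by rounding\<close>

lemma finite_feasible: "finite {S. feasible I S}"
  by (rule finite_subset[of _ "Pow {1..num I}"]) (auto simp: feasible_def)

lemma le_opt: "feasible I S \<Longrightarrow> total_profit I S \<le> opt I"
  unfolding opt_def by (intro Max_ge) (auto simp: finite_feasible)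

lemma feasible_empty: "sdsp_instance I \<Longrightarrow> feasible I {}"
  by (simp add: feasible_def compatible_set_def total_cost_def sdsp_instance_def)

lemma opt_attained:
  assumes "sdsp_instance I"
  obtains S where "feasible I S" "opt I = total_profit I S"
proof -
  have "opt I \<in> total_profit I ` {S. feasible I S}"
    unfolding opt_def using feasible_empty[OF assms] finite_feasible by (intro Max_in) auto
  then show thesis using that by auto
qed

lemma opt_nonneg: "sdsp_instance I \<Longrightarrow> 0 \<le> opt I"
  using le_opt[OF feasible_empty] by (simp add: total_profit_def)

lemma profit_le_opt: "\<lbrakk>j \<in> {1..num I}; cost I j \<le> budget I\<rbrakk> \<Longrightarrow> profit I j \<le> opt I"
  using le_opt[of I "{j}"]
  by (simp add: feasible_def compatible_set_def total_cost_def total_profit_def)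

text \<open>Rounding down \<open>N * p / M\<close>, stated without division so that
  \<open>M = 0\<close> is covered. The upper estimate is restricted to deliveries that fit into the
  budget alone, since only these occur in feasible sets.\<close>

definition scaling :: "sdsp \<Rightarrow> nat \<Rightarrow> real \<Rightarrow> (nat \<Rightarrow> nat) \<Rightarrow> bool" where
  "scaling I N M w \<longleftrightarrow> (\<forall>j\<in>{1..num I}. w j \<le> N \<and> real (w j) * M \<le> real N * profit I j \<and>
     (cost I j \<le> budget I \<longrightarrow> real N * profit I j \<le> (real (w j) + 1) * M))"

text \<open>Costs are positive, so a member costs no more than the whole set. This makes the upper
  estimate in \<open>scaling\<close> available for every member of an optimal set.\<close>

lemma feasible_cost_le:
  assumes "sdsp_instance I" "feasible I S" "j \<in> S"
  shows "cost I j \<le> budget I"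
proof -
  have S: "S \<subseteq> {1..num I}" using assms(2) by (simp add: feasible_def)
  then have "finite S" by (rule finite_subset) simp
  moreover have "0 \<le> cost I k" if "k \<in> S" for k
    using S assms(1) that by (auto simp: sdsp_instance_def less_imp_le)
  ultimately have "cost I j \<le> total_cost I S"
    unfolding total_cost_def using assms(3) by (intro member_le_sum) auto
  then show ?thesis using assms(2) by (simp add: feasible_def)
qed

text \<open>Multiplied by \<open>N\<close>, the optimum is at most the scaled profit of an optimal
  set times \<open>M\<close>, plus \<open>M\<close> for each rounding. The first part is at most
  \<open>q * M\<close>, hence at most \<open>N\<close> times the profit of the traced set; the
  second is at most \<open>num I * M\<close>, an \<epsilon> fraction of \<open>N\<close> times the
  optimum.\<close>

lemma trace_approx:
  assumes I: "sdsp_instance I" and N: "real (num I) \<le> \<epsilon> * real N" "0 < N"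
    and M: "0 \<le> M" "M \<le> opt I" and w: "scaling I N M w"
    and q: "mincost I w (num I) q \<le> budget I"
    and q_max: "\<And>q'. q' \<le> num I * N \<Longrightarrow> mincost I w (num I) q' \<le> budget I \<Longrightarrow> q' \<le> q"
  shows "feasible I (trace I w (num I) q)"
    and "(1 - \<epsilon>) * opt I \<le> total_profit I (trace I w (num I) q)"
proof -
  let ?T = "trace I w (num I) q"
  have T: "?T \<subseteq> {1..num I}" "compatible_set I ?T" "sum w ?T = q"
      "total_cost I ?T = mincost I w (num I) q"
    using trace_correct[OF I order_refl q, unfolded prefix_num] by blast+
  then show "feasible I ?T" using q by (simp add: feasible_def)
  obtain S where S: "feasible I S" "opt I = total_profit I S"
    using opt_attained[OF I] .
  have SI: "S \<subseteq> {1..num I}" and comp: "compatible_set I S" and cS: "total_cost I S \<le> budget I"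
    using S(1) by (auto simp: feasible_def)
  have cardS: "card S \<le> num I" using card_mono[OF _ SI] by simp
  \<comment> \<open>Every weight is at most \<open>N\<close>, so the scaled profit of an optimal set
    is among the columns covered by \<open>q_max\<close>.\<close>
  have "sum w S \<le> card S * N"
    using sum_bounded_above[of S w N] w SI by (auto simp: scaling_def)
  also have "\<dots> \<le> num I * N" using cardS by simp
  finally have sw: "sum w S \<le> num I * N" .
  have "mincost I w (num I) (sum w S) \<le> budget I"
    using mincost_le[OF I order_refl _ comp, of w] SI cS by (simp add: prefix_num)
  then have "sum w S \<le> q" using q_max sw by blast
  then have wq: "real (sum w S) * M \<le> real q * M" using M by (intro mult_right_mono) (simp_all only: of_nat_le_iff)
  have "real N * total_profit I S = (\<Sum>j\<in>S. real N * profit I j)"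
    by (simp add: total_profit_def sum_distrib_left)
  also have "\<dots> \<le> (\<Sum>j\<in>S. (real (w j) + 1) * M)"
    using w SI feasible_cost_le[OF I S(1)] by (intro sum_mono) (auto simp: scaling_def subset_iff)
  also have "\<dots> = real (sum w S) * M + real (card S) * M"
    by (simp add: distrib_right sum.distrib sum_distrib_right)
  also have "\<dots> \<le> real q * M + real (num I) * M"
    using cardS M by (intro add_mono wq mult_right_mono) simp_all
  also have "real q * M = (\<Sum>j\<in>?T. real (w j) * M)"
    using T(3) by (simp add: sum_distrib_right[symmetric] flip: of_nat_sum)
  also have "\<dots> \<le> (\<Sum>j\<in>?T. real N * profit I j)"
    using w T(1) by (intro sum_mono) (auto simp: scaling_def)
  also have "\<dots> = real N * total_profit I ?T"
    by (simp add: total_profit_def sum_distrib_left)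
  \<comment> \<open>The accuracy enters here: \<open>num I \<le> \<epsilon> * N\<close> and
    \<open>M \<le> opt I\<close>.\<close>
  also have "real (num I) * M \<le> \<epsilon> * real N * opt I"
    using N M opt_nonneg[OF I] by (intro mult_mono) auto
  finally have "real N * opt I \<le> real N * (total_profit I ?T + \<epsilon> * opt I)"
    using S(2) by (simp add: algebra_simps)
  then have "opt I \<le> total_profit I ?T + \<epsilon> * opt I"
    by (rule mult_left_le_imp_le) (simp add: N(2))
  then show "(1 - \<epsilon>) * opt I \<le> total_profit I ?T"
    by (simp add: algebra_simps)
qed


section \<open>Total correctness with time bounds\<close>

notation Then (infixr \<open>;;\<close> 60)

abbreviation nvar :: "string \<Rightarrow> nexp" where "nvar x \<equiv> NGet x (NConst 0)"
abbreviation rvar :: "string \<Rightarrow> rexp" where "rvar x \<equiv> RGet x (NConst 0)"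
abbreviation nset :: "string \<Rightarrow> nexp \<Rightarrow> com" where "nset x \<equiv> NPut x (NConst 0)"
abbreviation rset :: "string \<Rightarrow> rexp \<Rightarrow> com" where "rset x \<equiv> RPut x (NConst 0)"
abbreviation incr :: "string \<Rightarrow> com" where "incr x \<equiv> nset x (NAdd (nvar x) (NConst 1))"

lemma mem_put [simp]:
  "nmem (nput x i v s) = (nmem s)(x := (nmem s x)(i := v))"
  "rmem (nput x i v s) = rmem s"
  "nmem (rput x i r s) = nmem s"
  "rmem (rput x i r s) = (rmem s)(x := (rmem s x)(i := r))"
  by (simp_all add: nput_def rput_def)

text \<open>By determinism of \<open>exec\<close> the existential expresses total correctness. The
  time is only bounded from above, so branches of different length and loops with a varying body can
  be given one bound.\<close>

definition runs :: "com \<Rightarrow> mem \<Rightarrow> nat \<Rightarrow> (mem \<Rightarrow> bool) \<Rightarrow> bool" where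
  "runs c s T Q \<longleftrightarrow> (\<exists>t s'. exec c s t s' \<and> t \<le> T \<and> Q s')"

lemma runs_mono:
  "runs c s T P \<Longrightarrow> T \<le> T' \<Longrightarrow> (\<And>s'. P s' \<Longrightarrow> Q s') \<Longrightarrow> runs c s T' Q"
  unfolding runs_def by (meson order_trans)

lemma runs_Then:
  assumes "runs c s T P" "\<And>s'. P s' \<Longrightarrow> runs d s' U Q"
  shows "runs (c ;; d) s (T + U) Q"
  using assms unfolding runs_def by (meson exec.Then add_mono)

section \<open>Symbolic execution of loop-free code\<close>

primrec loop_free :: "com \<Rightarrow> bool" where
  "loop_free Skip \<longleftrightarrow> True"
| "loop_free (NPut x i a) \<longleftrightarrow> True"
| "loop_free (RPut x i a) \<longleftrightarrow> True"
| "loop_free (c ;; d) \<longleftrightarrow> loop_free c \<and> loop_free d"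
| "loop_free (Cond b c d) \<longleftrightarrow> loop_free c \<and> loop_free d"
| "loop_free (Loop b c) \<longleftrightarrow> False"

text \<open>Lets the simplifier compute the final memory of straight-line code.
  \<open>loop_free\<close> excludes the placeholder values that \<open>eff\<close> and
  \<open>ctime\<close> have on loops.\<close>

primrec eff :: "com \<Rightarrow> mem \<Rightarrow> mem" where
  "eff Skip s = s"
| "eff (NPut x i a) s = nput x (nval i s) (nval a s) s"
| "eff (RPut x i a) s = rput x (nval i s) (rval a s) s"
| "eff (c ;; d) s = eff d (eff c s)"
| "eff (Cond b c d) s = (if bval b s then eff c s else eff d s)"
| "eff (Loop b c) s = s"

primrec ctime :: "com \<Rightarrow> nat" where
  "ctime Skip = 1"
| "ctime (NPut x i a) = 1 + ntime i + ntime a"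
| "ctime (RPut x i a) = 1 + ntime i + rtime a"
| "ctime (c ;; d) = ctime c + ctime d"
| "ctime (Cond b c d) = 1 + btime b + max (ctime c) (ctime d)"
| "ctime (Loop b c) = 0"

lemma exec_loop_free: "loop_free c \<Longrightarrow> \<exists>t\<le>ctime c. exec c s t (eff c s)"
proof (induction c arbitrary: s)
  case (Then c d)
  then obtain t u where "t \<le> ctime c" "exec c s t (eff c s)"
    "u \<le> ctime d" "exec d (eff c s) u (eff d (eff c s))" by fastforce
  then show ?case by (auto intro!: exI[of _ "t + u"] exec.Then)
next
  case (Cond b c d)
  obtain t where t: "t \<le> ctime c" "exec c s t (eff c s)" using Cond by fastforce
  obtain u where u: "u \<le> ctime d" "exec d s u (eff d s)" using Cond by fastforce
  show ?case
  proof (cases "bval b s")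
    case True
    then show ?thesis using t
      by (intro exI[of _ "1 + btime b + t"] conjI) (simp, simp del: plus_nat.simps add: exec.CondTrue[simplified])
  next
    case False
    then show ?thesis using u
      by (intro exI[of _ "1 + btime b + u"] conjI) (simp, simp del: plus_nat.simps add: exec.CondFalse[simplified])
  qed
next
  case (NPut x i a)
  show ?case using exec.NPut[of x i a s] by (metis ctime.simps(2) eff.simps(2) order_refl)
next
  case (RPut x i a)
  show ?case using exec.RPut[of x i a s] by (metis ctime.simps(3) eff.simps(3) order_refl)
next
  case Skip
  show ?case using exec.Skip by auto
qed simp_all

lemma runs_loop_free: "loop_free c \<Longrightarrow> ctime c \<le> T \<Longrightarrow> Q (eff c s) \<Longrightarrow> runs c s T Q"
  unfolding runs_def using exec_loop_free[of c s] by (meson order_trans)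

lemma runs_loop_free_Then:
  assumes "loop_free c" "ctime c \<le> T" "runs d (eff c s) U Q"
  shows "runs (c ;; d) s (T + U) Q"
  using runs_Then[OF runs_loop_free[OF assms(1,2), where Q = "\<lambda>s'. s' = eff c s"]] assms(3)
  by simp

lemma runs_Then_loop_free:
  assumes "runs c s T P" "loop_free d" "ctime d \<le> U" "\<And>s'. P s' \<Longrightarrow> Q (eff d s')"
  shows "runs (c ;; d) s (T + U) Q"
  using runs_Then[OF assms(1)] runs_loop_free[OF assms(2,3)] assms(4) by blast

section \<open>Frame conditions and the loop rule\<close>

primrec writes :: "com \<Rightarrow> string set" where
  "writes Skip = {}"
| "writes (NPut x i a) = {x}"
| "writes (RPut x i a) = {x}"
| "writes (c ;; d) = writes c \<union> writes d"
| "writes (Cond b c d) = writes c \<union> writes d"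
| "writes (Loop b c) = writes c"

text \<open>Arrays of both sorts are addressed by the same names, so one set of names frames both
  memories.\<close>

definition agree_off :: "string set \<Rightarrow> mem \<Rightarrow> mem \<Rightarrow> bool" where
  "agree_off X s s' \<longleftrightarrow> (\<forall>x. x \<notin> X \<longrightarrow> nmem s' x = nmem s x \<and> rmem s' x = rmem s x)"

lemma agree_offD:
  assumes "agree_off X s s'"
  shows "x \<notin> X \<Longrightarrow> nmem s' x = nmem s x" "x \<notin> X \<Longrightarrow> rmem s' x = rmem s x"
  using assms by (auto simp: agree_off_def)

lemma exec_writes: "exec c s t s' \<Longrightarrow> agree_off (writes c) s s'"
  by (induction rule: exec.induct) (auto simp: agree_off_def)

lemma runs_frame: "runs c s T Q \<Longrightarrow> runs c s T (\<lambda>s'. Q s' \<and> agree_off (writes c) s s')"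
  unfolding runs_def using exec_writes by blast

lemma agree_off_trans: "agree_off X s s' \<Longrightarrow> agree_off X s' s'' \<Longrightarrow> agree_off X s s''"
  by (simp add: agree_off_def)

text \<open>The variant \<open>\<mu>\<close> decreases in each round, so there are at most
  \<open>m\<close> rounds and one final failing test, each paid for by \<open>K\<close>. Agreement
  with the state before the loop is carried along, so invariants only need to mention what the body
  changes.\<close>

lemma runs_Loop:
  assumes "J s"
    and step: "\<And>s'. J s' \<Longrightarrow> agree_off (writes c) s s' \<Longrightarrow> bval b s' \<Longrightarrow>
      runs c s' T (\<lambda>s''. J s'' \<and> \<mu> s'' < \<mu> s')"
    and bound: "\<mu> s \<le> m" "1 + btime b + T \<le> K"
  shows "runs (Loop b c) s ((m + 1) * K)
    (\<lambda>s'. J s' \<and> \<not> bval b s' \<and> agree_off (writes c) s s')"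
proof -
  have "\<exists>t s''. exec (Loop b c) s' t s'' \<and> t \<le> (\<mu> s' + 1) * K \<and>
      J s'' \<and> \<not> bval b s'' \<and> agree_off (writes c) s s''"
    if "J s'" "agree_off (writes c) s s'" for s'
    using that
  proof (induction "\<mu> s'" arbitrary: s' rule: less_induct)
    case less
    show ?case
    proof (cases "bval b s'")
      case False
      then show ?thesis
        using less.prems bound(2) exec.LoopFalse[of b s' c]
        by (intro exI[of _ "1 + btime b"] exI[of _ s']) simp
    next
      case True
      obtain t s1 where 1: "exec c s' t s1" "t \<le> T" "J s1" "\<mu> s1 < \<mu> s'"
        using step[OF less.prems True] by (auto simp: runs_def)
      have "agree_off (writes c) s s1"
        using less.prems(2) exec_writes[OF 1(1)] agree_off_trans by blast
      from less.hyps[OF 1(4) 1(3) this] obtain u s2 where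
        2: "exec (Loop b c) s1 u s2" "u \<le> (\<mu> s1 + 1) * K" "J s2" "\<not> bval b s2"
          "agree_off (writes c) s s2" by blast
      \<comment> \<open>A drop of the variant by at least one releases \<open>K\<close>, which pays
        for this round.\<close>
      have "(\<mu> s1 + 1) * K + K \<le> (\<mu> s' + 1) * K"
        using 1(4) mult_le_mono1[of "\<mu> s1 + 1 + 1" "\<mu> s' + 1" K] by (simp add: algebra_simps)
      then have "1 + btime b + t + u \<le> (\<mu> s' + 1) * K"
        using 1(2) 2(2) bound(2) by linarith
      then show ?thesis
        using exec.LoopTrue[OF True 1(1) 2(1)] 2 by blast
    qed
  qed
  from this[of s] assms(1) have "runs (Loop b c) s ((\<mu> s + 1) * K)
    (\<lambda>s'. J s' \<and> \<not> bval b s' \<and> agree_off (writes c) s s')"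
    by (auto simp: runs_def agree_off_def)
  then show ?thesis
    by (rule runs_mono) (use bound(1) in auto)
qed

text \<open>The common shape of all stages below: straight-line initialisation followed by a single
  loop.\<close>

lemma runs_init_Loop:
  assumes "loop_free d" "ctime d \<le> U" "J (eff d s)"
    and "\<And>s'. J s' \<Longrightarrow> agree_off (writes c) (eff d s) s' \<Longrightarrow> bval b s' \<Longrightarrow>
      runs c s' T (\<lambda>s''. J s'' \<and> \<mu> s'' < \<mu> s')"
    and "\<mu> (eff d s) \<le> m" "1 + btime b + T \<le> K"
    and Q: "\<And>s'. J s' \<Longrightarrow> agree_off (writes c) (eff d s) s' \<Longrightarrow> \<not> bval b s' \<Longrightarrow> Q s'"
  shows "runs (d ;; Loop b c) s (U + (m + 1) * K) Q"
proof (rule runs_loop_free_Then)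
  have "runs (Loop b c) (eff d s) ((m + 1) * K)
      (\<lambda>s'. J s' \<and> \<not> bval b s' \<and> agree_off (writes c) (eff d s) s')"
    by (rule runs_Loop; fact)
  then show "runs (Loop b c) (eff d s) ((m + 1) * K) Q"
    by (rule runs_mono) (use Q in auto)
qed (use assms in auto)


section \<open>The program\<close>

text \<open>The part of the input that stays true throughout the run, while equality with
  \<open>input I \<epsilon>\<close> is lost at the first assignment.\<close>

definition loaded :: "sdsp \<Rightarrow> real \<Rightarrow> mem \<Rightarrow> bool" where
  "loaded I \<epsilon> s \<longleftrightarrow> nmem s ''n'' 0 = num I \<and> rmem s ''eps'' 0 = \<epsilon> \<and> rmem s ''B'' 0 = budget I \<and>
    (\<forall>j. 1 \<le> j \<and> j \<le> num I \<longrightarrow> rmem s ''tL'' j = tL I j \<and> rmem s ''tR'' j = tR I j \<and>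
      rmem s ''c'' j = cost I j \<and> rmem s ''p'' j = profit I j)"

lemma loaded_input: "loaded I \<epsilon> (input I \<epsilon>)"
  by (simp add: loaded_def input_def Let_def)

lemma loadedD:
  assumes "loaded I \<epsilon> s"
  shows "nmem s ''n'' 0 = num I" "rmem s ''eps'' 0 = \<epsilon>" "rmem s ''B'' 0 = budget I"
    "1 \<le> j \<Longrightarrow> j \<le> num I \<Longrightarrow> rmem s ''tL'' j = tL I j"
    "1 \<le> j \<Longrightarrow> j \<le> num I \<Longrightarrow> rmem s ''tR'' j = tR I j"
    "1 \<le> j \<Longrightarrow> j \<le> num I \<Longrightarrow> rmem s ''c'' j = cost I j"
    "1 \<le> j \<Longrightarrow> j \<le> num I \<Longrightarrow> rmem s ''p'' j = profit I j"
  using assms by (auto simp: loaded_def)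

lemma loaded_agree_off:
  assumes "agree_off X s s'" "X \<inter> {''n'', ''eps'', ''B'', ''tL'', ''tR'', ''c'', ''p''} = {}"
    "loaded I \<epsilon> s"
  shows "loaded I \<epsilon> s'"
proof -
  have "nmem s' x = nmem s x" "rmem s' x = rmem s x"
    if "x \<in> {''n'', ''eps'', ''B'', ''tL'', ''tR'', ''c'', ''p''}" for x
    using assms(2) that agree_offD[OF assms(1)] by (metis disjoint_iff)+
  then show ?thesis
    using assms(3) unfolding loaded_def by (smt (verit) insert_iff)
qed


section \<open>The largest admissible profit and the scaling number\<close>

definition max_step :: com where
  "max_step = incr ''j'' ;; rset ''rn'' (RAdd (rvar ''rn'') (RConst 1)) ;;
     Cond (BAnd (BNot (RLess (rvar ''B'') (RGet ''c'' (nvar ''j''))))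
         (RLess (rvar ''M'') (RGet ''p'' (nvar ''j''))))
       (rset ''M'' (RGet ''p'' (nvar ''j''))) Skip"

definition max_prog :: com where
  "max_prog = (nset ''j'' (NConst 0) ;; rset ''rn'' (RConst 0) ;; rset ''M'' (RConst 0)) ;;
     Loop (NLess (nvar ''j'') (nvar ''n'')) max_step"

text \<open>A delivery that passes the budget test is feasible alone, hence \<open>M\<close> stays
  below the optimum. The machine cannot convert naturals to reals, so \<open>rn\<close> is counted
  up alongside \<open>j\<close> to have \<open>num I\<close> as a real.\<close>

lemma runs_max_prog:
  assumes I: "sdsp_instance I" and s: "loaded I \<epsilon> s"
  shows "runs max_prog s (10 + (num I + 1) * 50) (\<lambda>s'. rmem s' ''rn'' 0 = real (num I) \<and>
    0 \<le> rmem s' ''M'' 0 \<and> rmem s' ''M'' 0 \<le> opt I \<and>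
    (\<forall>j\<in>{1..num I}. cost I j \<le> budget I \<longrightarrow> profit I j \<le> rmem s' ''M'' 0))"
proof -
  define d where "d = nset ''j'' (NConst 0) ;; rset ''rn'' (RConst 0) ;; rset ''M'' (RConst 0)"
  define J where "J = (\<lambda>s' :: mem. nmem s' ''j'' 0 \<le> num I \<and> rmem s' ''rn'' 0 = real (nmem s' ''j'' 0) \<and>
    0 \<le> rmem s' ''M'' 0 \<and> rmem s' ''M'' 0 \<le> opt I \<and>
    (\<forall>j\<in>{1..nmem s' ''j'' 0}. cost I j \<le> budget I \<longrightarrow> profit I j \<le> rmem s' ''M'' 0))"
  have L: "loaded I \<epsilon> s'" if "agree_off (writes max_step) (eff d s) s'" for s'
    using s by (intro loaded_agree_off[OF that]) (simp_all add: max_step_def d_def loaded_def)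
  show ?thesis
    unfolding max_prog_def d_def[symmetric]
  proof (rule runs_init_Loop[where J = J and \<mu> = "\<lambda>s. num I - nmem s ''j'' 0" and T = "ctime max_step"])
    fix s' assume J: "J s'" and A: "agree_off (writes max_step) (eff d s) s'"
    note L = loadedD[OF L[OF A]]
    let ?b = "bval (NLess (nvar ''j'') (nvar ''n'')) s'"
    let ?j = "Suc (nmem s' ''j'' 0)"
    {
      assume ?b
      then have j: "?j \<le> num I" using L(1) by simp
      have "J (eff max_step s')"
        using J j L(1,2,3) L(4-)[of ?j] profit_le_opt[of ?j I]
        by (auto simp: J_def max_step_def atLeastAtMostSuc_conv)
      then show "runs max_step s' (ctime max_step)
          (\<lambda>s''. J s'' \<and> num I - nmem s'' ''j'' 0 < num I - nmem s' ''j'' 0)"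
        using j by (intro runs_loop_free) (auto simp: max_step_def)
    next
      assume "\<not> ?b"
      then have "nmem s' ''j'' 0 = num I" using J L(1) by (simp add: J_def)
      then show "rmem s' ''rn'' 0 = real (num I) \<and> 0 \<le> rmem s' ''M'' 0 \<and> rmem s' ''M'' 0 \<le> opt I \<and>
          (\<forall>j\<in>{1..num I}. cost I j \<le> budget I \<longrightarrow> profit I j \<le> rmem s' ''M'' 0)"
        using J by (simp add: J_def)
    }
  qed (use opt_nonneg[OF I] in \<open>simp_all add: max_step_def d_def J_def\<close>)
qed

definition count_step :: com where
  "count_step = rset ''acc'' (RAdd (rvar ''acc'') (rvar ''eps'')) ;; incr ''N''"

text \<open>Division by \<epsilon> through repeated addition. The loop continues on equality, so the
  final \<open>N\<close> satisfies a strict inequality and is positive even without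
  deliveries.\<close>

definition count_prog :: com where
  "count_prog = (nset ''N'' (NConst 0) ;; rset ''acc'' (RConst 0)) ;;
     Loop (BNot (RLess (rvar ''rn'') (rvar ''acc''))) count_step"

lemma runs_count_prog:
  assumes s: "loaded I \<epsilon> s" "rmem s ''rn'' 0 = real (num I)" and \<epsilon>: "0 < \<epsilon>"
    and F: "F = nat \<lfloor>real (num I) / \<epsilon>\<rfloor>"
  shows "runs count_prog s (10 + (F + 1 + 1) * 50)
    (\<lambda>s'. real (num I) < \<epsilon> * real (nmem s' ''N'' 0) \<and> nmem s' ''N'' 0 \<le> F + 1)"
proof -
  define d where "d = nset ''N'' (NConst 0) ;; rset ''acc'' (RConst 0)"
  define J where "J = (\<lambda>s' :: mem. rmem s' ''acc'' 0 = \<epsilon> * real (nmem s' ''N'' 0) \<and> nmem s' ''N'' 0 \<le> F + 1)"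
  have L: "loaded I \<epsilon> s'" "rmem s' ''rn'' 0 = real (num I)"
    if A: "agree_off (writes count_step) (eff d s) s'" for s'
    using s
    by (intro loaded_agree_off[OF A]; simp add: count_step_def d_def loaded_def)
      (simp_all add: s agree_offD[OF A] count_step_def d_def)
  show ?thesis
    unfolding count_prog_def d_def[symmetric]
  proof (rule runs_init_Loop[where J = J and \<mu> = "\<lambda>s. F + 1 - nmem s ''N'' 0" and T = "ctime count_step"])
    fix s' assume J: "J s'" and A: "agree_off (writes count_step) (eff d s) s'"
    let ?b = "bval (BNot (RLess (rvar ''rn'') (rvar ''acc''))) s'"
    let ?N = "nmem s' ''N'' 0"
    {
      assume ?b
      then have "\<epsilon> * real ?N \<le> real (num I)" using J L(2)[OF A] by (simp add: J_def)
      then have "real ?N \<le> real (num I) / \<epsilon>" using \<epsilon> by (simp add: field_simps)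
      \<comment> \<open>Another round starts only while \<open>N\<close> is at most the floor of
        \<open>num I / \<epsilon>\<close>; hence the final bound \<open>F + 1\<close>.\<close>
      then have N: "?N \<le> F" unfolding F by (simp add: le_nat_floor)
      then have "J (eff count_step s')"
        using J loadedD[OF L(1)[OF A]]
        by (auto simp: J_def count_step_def algebra_simps)
      then show "runs count_step s' (ctime count_step)
          (\<lambda>s''. J s'' \<and> F + 1 - nmem s'' ''N'' 0 < F + 1 - nmem s' ''N'' 0)"
        using N by (intro runs_loop_free) (auto simp: count_step_def)
    next
      assume "\<not> ?b"
      then show "real (num I) < \<epsilon> * real ?N \<and> ?N \<le> F + 1"
        using J L(2)[OF A] by (simp add: J_def)
    }
  qed (simp_all add: count_step_def d_def J_def)
qed

section \<open>Rounded profits by repeated subtraction\<close>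

text \<open>
  Repeated subtraction of \<open>M\<close> from the multiples of \<open>p\<^sub>j\<close> yields \<open>w\<^sub>j = \<lfloor>N p\<^sub>j / M\<rfloor>\<close> in \<open>N\<close> steps
  when \<open>p\<^sub>j \<le> M\<close>. If \<open>p\<^sub>j > M\<close> (then \<open>j\<close> exceeds the budget on its own), \<open>w\<^sub>j\<close> is merely at most \<open>N\<close>;
  if \<open>M = 0\<close>, it is \<open>N\<close>.
\<close>

definition scale_step :: com where
  "scale_step = incr ''k'' ;; rset ''rem'' (RAdd (rvar ''rem'') (RGet ''p'' (nvar ''j''))) ;;
     Cond (RLess (rvar ''rem'') (rvar ''M'')) Skip
       (rset ''rem'' (RSub (rvar ''rem'') (rvar ''M'')) ;;
        NPut ''w'' (nvar ''j'') (NAdd (NGet ''w'' (nvar ''j'')) (NConst 1)))"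

definition scale_prog :: com where
  "scale_prog = (nset ''k'' (NConst 0) ;; rset ''rem'' (RConst 0) ;; NPut ''w'' (nvar ''j'') (NConst 0)) ;;
     Loop (NLess (nvar ''k'') (nvar ''N'')) scale_step"

lemma runs_scale_prog:
  assumes I: "sdsp_instance I" and s: "loaded I \<epsilon> s" "nmem s ''j'' 0 = j" "nmem s ''N'' 0 = N"
      "rmem s ''M'' 0 = M"
    and j: "j \<in> {1..num I}" and M: "0 \<le> M" "cost I j \<le> budget I \<Longrightarrow> profit I j \<le> M"
  shows "runs scale_prog s (10 + (N + 1) * 50)
    (\<lambda>s'. (let v = nmem s' ''w'' j in v \<le> N \<and> real v * M \<le> real N * profit I j \<and>
       (cost I j \<le> budget I \<longrightarrow> real N * profit I j \<le> (real v + 1) * M)) \<and>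
       (\<forall>i. i \<noteq> j \<longrightarrow> nmem s' ''w'' i = nmem s ''w'' i))"
proof -
  define d where "d = nset ''k'' (NConst 0) ;; rset ''rem'' (RConst 0) ;; NPut ''w'' (nvar ''j'') (NConst 0)"
  \<comment> \<open>Division with remainder: \<open>rem + w * M = k * p\<close>. One subtraction per
    round keeps \<open>rem \<le> M\<close> when \<open>p \<le> M\<close>, and in every case
    \<open>w \<le> k\<close>. The bound on \<open>rem\<close> is not strict, which allows
    \<open>M = 0\<close>.\<close>
  define J where "J = (\<lambda>s' :: mem. nmem s' ''k'' 0 \<le> N \<and> nmem s' ''w'' j \<le> nmem s' ''k'' 0 \<and>
     rmem s' ''rem'' 0 + real (nmem s' ''w'' j) * M = real (nmem s' ''k'' 0) * profit I j \<and>
     0 \<le> rmem s' ''rem'' 0 \<and> (cost I j \<le> budget I \<longrightarrow> rmem s' ''rem'' 0 \<le> M) \<and>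
     (\<forall>i. i \<noteq> j \<longrightarrow> nmem s' ''w'' i = nmem s ''w'' i))"
  have pj: "0 \<le> profit I j" using I j by (auto simp: sdsp_instance_def)
  have L: "loaded I \<epsilon> s'" "nmem s' ''j'' 0 = j" "nmem s' ''N'' 0 = N" "rmem s' ''M'' 0 = M"
    if A: "agree_off (writes scale_step) (eff d s) s'" for s'
    using s
    by (intro loaded_agree_off[OF A]; simp add: scale_step_def d_def loaded_def)
      (simp_all add: s agree_offD[OF A] scale_step_def d_def)
  show ?thesis
    unfolding scale_prog_def d_def[symmetric]
  proof (rule runs_init_Loop[where J = J and \<mu> = "\<lambda>s. N - nmem s ''k'' 0" and T = "ctime scale_step"])
    fix s' assume J: "J s'" and A: "agree_off (writes scale_step) (eff d s) s'"
    let ?b = "bval (NLess (nvar ''k'') (nvar ''N'')) s'"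
    have p: "rmem s' ''p'' j = profit I j" using loadedD(7)[OF L(1)[OF A]] j by simp
    {
      assume ?b
      then have k: "nmem s' ''k'' 0 < N" using L(3)[OF A] by simp
      have "J (eff scale_step s')"
        using J k L(2-)[OF A] p pj M
        by (auto simp: J_def scale_step_def algebra_simps)
      then show "runs scale_step s' (ctime scale_step)
          (\<lambda>s''. J s'' \<and> N - nmem s'' ''k'' 0 < N - nmem s' ''k'' 0)"
        using k by (intro runs_loop_free) (auto simp: scale_step_def)
    next
      assume "\<not> ?b"
      then have "nmem s' ''k'' 0 = N" using J L(3)[OF A] by (simp add: J_def)
      then show "(let v = nmem s' ''w'' j in v \<le> N \<and> real v * M \<le> real N * profit I j \<and>
       (cost I j \<le> budget I \<longrightarrow> real N * profit I j \<le> (real v + 1) * M)) \<and>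
       (\<forall>i. i \<noteq> j \<longrightarrow> nmem s' ''w'' i = nmem s ''w'' i)"
        using J by (auto simp: J_def Let_def algebra_simps)
    }
  qed (use s M in \<open>simp_all add: scale_step_def d_def J_def\<close>)
qed

section \<open>Ranks, predecessors and the inverse permutation\<close>

text \<open>The negated conjunction is the disjunction in \<open>upto_set_def\<close>.\<close>

definition rank_step :: com where
  "rank_step = incr ''k'' ;;
     Cond (BAnd (BNot (RLess (RGet ''tR'' (nvar ''k'')) (RGet ''tR'' (nvar ''j''))))
         (BNot (BAnd (BNot (RLess (RGet ''tR'' (nvar ''j'')) (RGet ''tR'' (nvar ''k''))))
           (BNot (NLess (nvar ''j'') (nvar ''k''))))))
       Skip (incr ''rank'') ;;
     Cond (RLess (RGet ''tR'' (nvar ''k'')) (RGet ''tL'' (nvar ''j'')))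
       (NPut ''pred'' (nvar ''j'') (NAdd (NGet ''pred'' (nvar ''j'')) (NConst 1))) Skip"

definition rank_prog :: com where
  "rank_prog = (nset ''k'' (NConst 0) ;; nset ''rank'' (NConst 0) ;; NPut ''pred'' (nvar ''j'') (NConst 0)) ;;
     Loop (NLess (nvar ''k'') (nvar ''n'')) rank_step"

text \<open>Describes how both counters of \<open>rank_step\<close> grow when \<open>k\<close>
  advances.\<close>

lemma card_filter_Suc:
  "card {k \<in> {1..Suc m}. P k} = card {k \<in> {1..m}. P k} + (if P (Suc m) then 1 else 0)"
proof -
  have "{k \<in> {1..Suc m}. P k} = (if P (Suc m) then insert (Suc m) {k \<in> {1..m}. P k} else {k \<in> {1..m}. P k})"
    by (auto simp: le_Suc_eq)
  then show ?thesis by (simp add: card_insert_if)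
qed

lemma runs_rank_prog:
  assumes s: "loaded I \<epsilon> s" "nmem s ''j'' 0 = j" and j: "j \<in> {1..num I}"
  shows "runs rank_prog s (10 + (num I + 1) * 70)
    (\<lambda>s'. nmem s' ''rank'' 0 = rank I j \<and> nmem s' ''pred'' j = npred I j \<and>
       (\<forall>i. i \<noteq> j \<longrightarrow> nmem s' ''pred'' i = nmem s ''pred'' i))"
proof -
  define d where "d = nset ''k'' (NConst 0) ;; nset ''rank'' (NConst 0) ;; NPut ''pred'' (nvar ''j'') (NConst 0)"
  define P where "P = (\<lambda>k. tR I k < tR I j \<or> \<not> tR I j < tR I k \<and> k \<le> j)"
  define R where "R = (\<lambda>k. tR I k < tL I j)"
  define J where "J = (\<lambda>s' :: mem. nmem s' ''k'' 0 \<le> num I \<and>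
     nmem s' ''rank'' 0 = card {k \<in> {1..nmem s' ''k'' 0}. P k} \<and>
     nmem s' ''pred'' j = card {k \<in> {1..nmem s' ''k'' 0}. R k} \<and>
     (\<forall>i. i \<noteq> j \<longrightarrow> nmem s' ''pred'' i = nmem s ''pred'' i))"
  have L: "loaded I \<epsilon> s'" "nmem s' ''j'' 0 = j"
    if A: "agree_off (writes rank_step) (eff d s) s'" for s'
    using s
    by (intro loaded_agree_off[OF A]; simp add: rank_step_def d_def loaded_def)
      (simp_all add: s agree_offD[OF A] rank_step_def d_def)
  show ?thesis
    unfolding rank_prog_def d_def[symmetric]
  proof (rule runs_init_Loop[where J = J and \<mu> = "\<lambda>s. num I - nmem s ''k'' 0" and T = "ctime rank_step"])
    fix s' assume J: "J s'" and A: "agree_off (writes rank_step) (eff d s) s'"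
    note L = loadedD[OF L(1)[OF A]] L(2)[OF A]
    let ?b = "bval (NLess (nvar ''k'') (nvar ''n'')) s'"
    let ?k = "Suc (nmem s' ''k'' 0)"
    {
      assume ?b
      then have k: "?k \<le> num I" using L(1) by simp
      have t: "rmem s' ''tR'' j = tR I j" "rmem s' ''tL'' j = tL I j" "rmem s' ''tR'' ?k = tR I ?k"
        using L(4,5)[of j] L(5)[of ?k] j k by auto
      have "nmem (eff rank_step s') ''rank'' 0 = nmem s' ''rank'' 0 + (if P ?k then 1 else 0)"
        "nmem (eff rank_step s') ''pred'' j = nmem s' ''pred'' j + (if R ?k then 1 else 0)"
        "nmem (eff rank_step s') ''k'' 0 = ?k"
        "\<forall>i. i \<noteq> j \<longrightarrow> nmem (eff rank_step s') ''pred'' i = nmem s' ''pred'' i"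
        using t L(8) by (auto simp: rank_step_def P_def R_def not_less)
      then have "J (eff rank_step s')"
        using J k unfolding J_def by (simp only: card_filter_Suc) simp
      then show "runs rank_step s' (ctime rank_step)
          (\<lambda>s''. J s'' \<and> num I - nmem s'' ''k'' 0 < num I - nmem s' ''k'' 0)"
        using k by (intro runs_loop_free) (auto simp: rank_step_def)
    next
      assume "\<not> ?b"
      then have "nmem s' ''k'' 0 = num I" using J L(1) by (simp add: J_def)
      then show "nmem s' ''rank'' 0 = rank I j \<and> nmem s' ''pred'' j = npred I j \<and>
       (\<forall>i. i \<noteq> j \<longrightarrow> nmem s' ''pred'' i = nmem s ''pred'' i)"
        using J by (auto simp: J_def rank_def upto_set_def npred_def P_def R_def)
    }
  qed (use s in \<open>simp_all add: rank_step_def d_def J_def\<close>)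
qed


text \<open>In place of sorting, each \<open>j\<close> is stored at its rank. \<open>W\<close>, the
  number of columns of the table, is accumulated as \<open>1 + j * N\<close>, since the machine has
  no multiplication.\<close>

definition prep_step :: com where
  "prep_step = (incr ''j'' ;; nset ''W'' (NAdd (nvar ''W'') (nvar ''N''))) ;;
     scale_prog ;; rank_prog ;; NPut ''item'' (nvar ''rank'') (nvar ''j'')"

definition prep_prog :: com where
  "prep_prog = (nset ''j'' (NConst 0) ;; nset ''W'' (NConst 1)) ;;
     Loop (NLess (nvar ''j'') (nvar ''n'')) prep_step"

definition prepared :: "sdsp \<Rightarrow> mem \<Rightarrow> bool" where
  "prepared I s \<longleftrightarrow> nmem s ''W'' 0 = 1 + num I * nmem s ''N'' 0 \<and>
     scaling I (nmem s ''N'' 0) (rmem s ''M'' 0) (nmem s ''w'') \<and>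
     (\<forall>j\<in>{1..num I}. nmem s ''pred'' j = npred I j) \<and>
     (\<forall>i\<in>{1..num I}. nmem s ''item'' i = item I i)"

text \<open>Each delivery takes time linear in \<open>N + num I\<close>: \<open>N\<close> rounds of
  scaling and \<open>num I\<close> comparisons of endpoints.\<close>

lemma runs_prep_prog:
  assumes I: "sdsp_instance I" and s: "loaded I \<epsilon> s" "nmem s ''N'' 0 = N" "rmem s ''M'' 0 = M"
    and M: "0 \<le> M" "\<forall>j\<in>{1..num I}. cost I j \<le> budget I \<longrightarrow> profit I j \<le> M"
  shows "runs prep_prog s (10 + (num I + 1) * ((N + num I + 2) * 100)) (prepared I)"
proof -
  define d where "d = nset ''j'' (NConst 0) ;; nset ''W'' (NConst 1)"
  define good where "good = (\<lambda>v j. v \<le> N \<and> real v * M \<le> real N * profit I j \<and>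
       (cost I j \<le> budget I \<longrightarrow> real N * profit I j \<le> (real v + 1) * M))"
  define J where "J = (\<lambda>s' :: mem. nmem s' ''j'' 0 \<le> num I \<and> nmem s' ''W'' 0 = 1 + nmem s' ''j'' 0 * N \<and>
     (\<forall>j\<in>{1..nmem s' ''j'' 0}. good (nmem s' ''w'' j) j \<and> nmem s' ''pred'' j = npred I j \<and>
        nmem s' ''item'' (rank I j) = j))"
  have L: "loaded I \<epsilon> s'" "nmem s' ''N'' 0 = N" "rmem s' ''M'' 0 = M"
    if A: "agree_off (writes prep_step) (eff d s) s'" for s'
    using s
    by (intro loaded_agree_off[OF A]; simp add: prep_step_def scale_prog_def scale_step_def
        rank_prog_def rank_step_def d_def loaded_def)
      (simp_all add: s agree_offD[OF A] prep_step_def scale_prog_def scale_step_def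
        rank_prog_def rank_step_def d_def)
  show ?thesis
    unfolding prep_prog_def d_def[symmetric]
  proof (rule runs_init_Loop[where J = J and \<mu> = "\<lambda>s. num I - nmem s ''j'' 0"
        and T = "20 + (10 + (N + 1) * 50) + (10 + (num I + 1) * 70) + 10"])
    fix s' assume J: "J s'" and A: "agree_off (writes prep_step) (eff d s) s'"
    note L = L[OF A] note L1 = loadedD[OF L(1)]
    let ?b = "bval (NLess (nvar ''j'') (nvar ''n'')) s'"
    let ?j = "Suc (nmem s' ''j'' 0)"
    {
      assume ?b
      then have j: "?j \<in> {1..num I}" using L1(1) by simp
      let ?e = "incr ''j'' ;; nset ''W'' (NAdd (nvar ''W'') (nvar ''N''))"
      let ?s1 = "eff ?e s'"
      let ?P2 = "\<lambda>s2. (let v = nmem s2 ''w'' ?j in good v ?j) \<and>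
        (\<forall>i. i \<noteq> ?j \<longrightarrow> nmem s2 ''w'' i = nmem ?s1 ''w'' i)"
      let ?Q = "\<lambda>s''. J s'' \<and> num I - nmem s'' ''j'' 0 < num I - nmem s' ''j'' 0"
      have 2: "runs scale_prog ?s1 (10 + (N + 1) * 50)
          (\<lambda>s2. ?P2 s2 \<and> agree_off (writes scale_prog) ?s1 s2)"
        unfolding good_def
        by (rule runs_frame, rule runs_scale_prog[OF I, of \<epsilon>])
          (use L L1 j M in \<open>auto simp: loaded_def\<close>)
      have 3: "runs (rank_prog ;; NPut ''item'' (nvar ''rank'') (nvar ''j'')) s2
          ((10 + (num I + 1) * 70) + 10) ?Q"
        if P2: "?P2 s2" and A2: "agree_off (writes scale_prog) ?s1 s2" for s2
      proof -
        note f2 = agree_offD[OF A2, unfolded scale_prog_def scale_step_def]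
        have ld2: "loaded I \<epsilon> s2"
          by (rule loaded_agree_off[OF A2]) (use L(1) in \<open>simp_all add: scale_prog_def scale_step_def loaded_def\<close>)
        have j2: "nmem s2 ''j'' 0 = ?j" by (simp add: f2)
        show ?thesis
        proof (rule runs_Then_loop_free[OF runs_frame[OF runs_rank_prog[OF ld2 j2 j]]])
          fix s3
          assume 3: "(nmem s3 ''rank'' 0 = rank I ?j \<and> nmem s3 ''pred'' ?j = npred I ?j \<and>
             (\<forall>i. i \<noteq> ?j \<longrightarrow> nmem s3 ''pred'' i = nmem s2 ''pred'' i)) \<and> agree_off (writes rank_prog) s2 s3"
          then have A3: "agree_off (writes rank_prog) s2 s3" by blast
          note f3 = agree_offD[OF A3, unfolded rank_prog_def rank_step_def]
          let ?s4 = "eff (NPut ''item'' (nvar ''rank'') (nvar ''j'')) s3"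
          have w: "nmem ?s4 ''w'' = nmem s2 ''w''" by (simp add: f3)
          have p: "nmem ?s4 ''pred'' = nmem s3 ''pred''" by simp
          have it: "nmem ?s4 ''item'' = (nmem s' ''item'')(rank I ?j := ?j)"
            using 3 by (simp add: f3 f2)
          have sc: "nmem ?s4 ''j'' 0 = ?j" "nmem ?s4 ''W'' 0 = nmem s' ''W'' 0 + N"
            using L by (simp_all add: f3 f2)
          have all: "good (nmem ?s4 ''w'' i) i \<and> nmem ?s4 ''pred'' i = npred I i \<and>
              nmem ?s4 ''item'' (rank I i) = i" if i: "i \<in> {1..?j}" for i
          proof (cases "i = ?j")
            case True
            then show ?thesis using P2 3 unfolding w p it by (simp add: Let_def)
          next
            case False
            then have i': "i \<in> {1..nmem s' ''j'' 0}" using i by simp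
            then have "i \<in> {1..num I}" using j by simp
            \<comment> \<open>Ranks are distinct, so storing \<open>?j\<close> does not overwrite
              the entry of an earlier delivery.\<close>
            then have "rank I i \<noteq> rank I ?j"
              using inj_onD[OF inj_on_rank _ _ j] False by blast
            moreover have "nmem s2 ''w'' i = nmem s' ''w'' i" using P2 False by simp
            moreover have "nmem s3 ''pred'' i = nmem s' ''pred'' i" using 3 False by (simp add: f2)
            ultimately show ?thesis using J i' unfolding w p it J_def by simp
          qed
          have "\<forall>i\<in>{1..nmem ?s4 ''j'' 0}. good (nmem ?s4 ''w'' i) i \<and>
              nmem ?s4 ''pred'' i = npred I i \<and> nmem ?s4 ''item'' (rank I i) = i"
            unfolding sc(1) using all by blast
          moreover have "nmem ?s4 ''j'' 0 \<le> num I"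
              "nmem ?s4 ''W'' 0 = 1 + nmem ?s4 ''j'' 0 * N"
            unfolding sc using J j by (simp_all add: J_def)
          ultimately have "J ?s4" unfolding J_def by blast
          then show "?Q ?s4" using sc j by simp
        qed simp_all
      qed
      have "runs prep_step s' (20 + ((10 + (N + 1) * 50) + ((10 + (num I + 1) * 70) + 10))) ?Q"
        unfolding prep_step_def
        by (rule runs_loop_free_Then[OF _ _ runs_Then[OF 2]]) (use 3 in \<open>auto simp del: eff.simps\<close>)
      then show "runs prep_step s' (20 + (10 + (N + 1) * 50) + (10 + (num I + 1) * 70) + 10) ?Q"
        by (simp add: add.assoc)
    next
      assume "\<not> ?b"
      then have n: "nmem s' ''j'' 0 = num I" using J L1(1) by (simp add: J_def)
      \<comment> \<open>The invariant speaks of positions \<open>rank I j\<close>; every position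
        \<open>i\<close> is of this form with \<open>j = item I i\<close>.\<close>
      have "nmem s' ''item'' i = item I i" if i: "i \<in> {1..num I}" for i
      proof -
        have "nmem s' ''item'' (rank I (item I i)) = item I i"
          using J n item_in[OF i] unfolding J_def by simp
        then show ?thesis using rank_item[OF i] by simp
      qed
      then show "prepared I s'"
        using J L n by (simp add: J_def prepared_def scaling_def good_def)
    }
  qed (simp_all add: d_def J_def)
qed

section \<open>Filling the table row by row\<close>

text \<open>The table is one array in row-major order. \<open>b\<close> is the offset of the current
  row, the cell above is \<open>W\<close> places earlier, and the offsets of other rows are looked
  up in \<open>row\<close>, which avoids multiplication.\<close>

definition cell_prog :: com where
  "cell_prog = Cond (NLess (NConst 0) (nvar ''i''))
     (nset ''j'' (NGet ''item'' (nvar ''i'')) ;;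
      rset ''x'' (RGet ''h'' (NSub (NAdd (nvar ''b'') (nvar ''q'')) (nvar ''W''))) ;;
      Cond (NLess (nvar ''q'') (NGet ''w'' (nvar ''j''))) Skip
        (rset ''y'' (RAdd (RGet ''c'' (nvar ''j''))
            (RGet ''h'' (NAdd (NGet ''row'' (NGet ''pred'' (nvar ''j'')))
              (NSub (nvar ''q'') (NGet ''w'' (nvar ''j'')))))) ;;
         Cond (RLess (rvar ''y'') (rvar ''x'')) (rset ''x'' (rvar ''y'')) Skip))
     (Cond (NLess (NConst 0) (nvar ''q'')) (rset ''x'' (RAdd (rvar ''B'') (RConst 1)))
        (rset ''x'' (RConst 0))) ;;
   RPut ''h'' (NAdd (nvar ''b'') (nvar ''q'')) (rvar ''x'') ;; incr ''q''"

definition row_prog :: com where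
  "row_prog = (NPut ''row'' (nvar ''i'') (nvar ''b'') ;; nset ''q'' (NConst 0)) ;;
     Loop (NLess (nvar ''q'') (nvar ''W'')) cell_prog"

definition table_step :: com where
  "table_step = row_prog ;; incr ''i'' ;; nset ''b'' (NAdd (nvar ''b'') (nvar ''W''))"

definition table_prog :: com where
  "table_prog = (nset ''i'' (NConst 0) ;; nset ''b'' (NConst 0)) ;;
     Loop (BNot (NLess (nvar ''n'') (nvar ''i''))) table_step"

text \<open>A single count of cells in row-major order also describes a partly filled row.\<close>

definition filled :: "sdsp \<Rightarrow> (nat \<Rightarrow> nat) \<Rightarrow> nat \<Rightarrow> nat \<Rightarrow> mem \<Rightarrow> bool" where
  "filled I w W m s \<longleftrightarrow> (\<forall>x<m. rmem s ''h'' x = mincost I w (x div W) (x mod W))"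

lemma prepared_agree_off:
  assumes "agree_off X s s'" "prepared I s" "X \<inter> {''W'', ''N'', ''M'', ''w'', ''pred'', ''item''} = {}"
  shows "prepared I s'"
proof -
  have "nmem s' x = nmem s x" "rmem s' x = rmem s x"
    if "x \<in> {''W'', ''N'', ''M'', ''w'', ''pred'', ''item''}" for x
    using assms(3) that agree_offD[OF assms(1)] by (metis disjoint_iff)+
  then show ?thesis
    using assms(2) unfolding prepared_def by simp
qed

lemma eff_cell_prog:
  assumes I: "sdsp_instance I" and s: "loaded I \<epsilon> s" "prepared I s" "nmem s ''W'' 0 = W" "nmem s ''w'' = w"
    and i: "nmem s ''i'' 0 = i" "i \<le> num I" "nmem s ''b'' 0 = i * W"
    and q: "nmem s ''q'' 0 = q" "q < W"
    and rows: "\<forall>k\<le>i. nmem s ''row'' k = k * W"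
    and h: "filled I w W (i * W + q) s"
  shows "filled I w W (i * W + Suc q) (eff cell_prog s)"
proof -
  \<comment> \<open>All rows before the current one lie completely within the filled part.\<close>
  have look: "rmem s ''h'' (k * W + r) = mincost I w k r" if "k < i" "r < W" for k r
  proof -
    have "k * W + r < Suc k * W" using that by simp
    also have "\<dots> \<le> i * W" using that by (intro mult_le_mono1) simp
    finally have "k * W + r < i * W + q" by simp
    then show ?thesis using h that by (simp add: filled_def)
  qed
  have "rmem (eff cell_prog s) ''h'' = (rmem s ''h'')(i * W + q := mincost I w i q)"
  proof (cases i)
    case 0
    then show ?thesis using s i q loadedD[OF s(1)] by (simp add: cell_prog_def)
  next
    case (Suc i')
    define j where "j = item I i"
    have i1: "i \<in> {1..num I}" using i Suc by simp
    have j: "j \<in> {1..num I}" "rank I j = i" using item_in[OF i1] rank_item[OF i1] by (auto simp: j_def)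
    have "npred I j < i"
      using npred_less[of j I] j I by (auto simp: sdsp_instance_def)
    then have np: "npred I j \<le> i'" "npred I j < i" using Suc by auto
    have m: "nmem s ''item'' i = j" "nmem s ''pred'' j = npred I j" "rmem s ''c'' j = cost I j"
      using s j i1 loadedD(6)[OF s(1), of j] by (auto simp: prepared_def j_def)
    have "i * W + q - W = i' * W + q" using Suc by simp
    then have x: "rmem s ''h'' (i * W + q - W) = mincost I w i' q"
      using look[of i' q] Suc q by simp
    have y: "rmem s ''h'' (npred I j * W + (q - w j)) = mincost I w (npred I j) (q - w j)"
      using look[of "npred I j" "q - w j"] np q by simp
    \<comment> \<open>The same cell with its address regrouped; \<open>w j \<le> q\<close> prevents
      truncation.\<close>
    then have y': "rmem s ''h'' (npred I j * W + q - w j) = mincost I w (npred I j) (q - w j)" if "w j \<le> q"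
    using that by simp
  have row: "nmem s ''row'' (npred I j) = npred I j * W" using rows np by simp
    have H: "mincost I w i q = (if w j \<le> q \<and> cost I j + mincost I w (npred I j) (q - w j) < mincost I w i' q
        then cost I j + mincost I w (npred I j) (q - w j) else mincost I w i' q)"
      unfolding Suc mincost.simps(2) using j_def Suc np by (simp add: Let_def min_absorb2 add.commute)
    show ?thesis
      unfolding H using s(3,4) i q m x y y' row Suc by (simp add: cell_prog_def not_less)
  qed
  then show ?thesis
    using h q by (auto simp: filled_def less_Suc_eq)
qed

lemma runs_row_prog:
  assumes I: "sdsp_instance I" and s: "loaded I \<epsilon> s" "prepared I s" "nmem s ''W'' 0 = W" "nmem s ''w'' = w"
    and i: "nmem s ''i'' 0 = i" "i \<le> num I" "nmem s ''b'' 0 = i * W"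
    and rows: "\<forall>k<i. nmem s ''row'' k = k * W"
    and h: "filled I w W (i * W) s"
  shows "runs row_prog s (10 + (W + 1) * 100)
    (\<lambda>s'. filled I w W (Suc i * W) s' \<and> (\<forall>k\<le>i. nmem s' ''row'' k = k * W))"
proof -
  define d where "d = NPut ''row'' (nvar ''i'') (nvar ''b'') ;; nset ''q'' (NConst 0)"
  define J where "J = (\<lambda>s' :: mem. nmem s' ''q'' 0 \<le> W \<and> filled I w W (i * W + nmem s' ''q'' 0) s')"
  have L: "loaded I \<epsilon> s'" "prepared I s'" "nmem s' ''W'' 0 = W" "nmem s' ''w'' = w" "nmem s' ''i'' 0 = i"
      "nmem s' ''b'' 0 = i * W" "\<forall>k\<le>i. nmem s' ''row'' k = k * W"
    if A: "agree_off (writes cell_prog) (eff d s) s'" for s'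
  proof -
    show "loaded I \<epsilon> s'"
      by (rule loaded_agree_off[OF A]) (use s(1) in \<open>simp_all add: cell_prog_def d_def loaded_def\<close>)
    show "prepared I s'"
      by (rule prepared_agree_off[OF A]) (use s(2) in \<open>simp_all add: cell_prog_def d_def prepared_def\<close>)
  qed (use rows s i in \<open>simp_all add: agree_offD[OF A] cell_prog_def d_def le_less\<close>)
  show ?thesis
    unfolding row_prog_def d_def[symmetric]
  proof (rule runs_init_Loop[where J = J and \<mu> = "\<lambda>s. W - nmem s ''q'' 0" and T = "ctime cell_prog"])
    fix s' assume J: "J s'" and A: "agree_off (writes cell_prog) (eff d s) s'"
    note L = L[OF A]
    let ?b = "bval (NLess (nvar ''q'') (nvar ''W'')) s'"
    {
      assume ?b
      then have q: "nmem s' ''q'' 0 < W" using L(3) by simp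
      have "filled I w W (i * W + Suc (nmem s' ''q'' 0)) (eff cell_prog s')"
        by (rule eff_cell_prog[OF I L(1-5) i(2) L(6) refl q L(7)]) (use J in \<open>simp add: J_def\<close>)
      moreover have q': "nmem (eff cell_prog s') ''q'' 0 = Suc (nmem s' ''q'' 0)"
        by (simp add: cell_prog_def)
      ultimately have "J (eff cell_prog s')" using q by (simp add: J_def)
      then show "runs cell_prog s' (ctime cell_prog)
          (\<lambda>s''. J s'' \<and> W - nmem s'' ''q'' 0 < W - nmem s' ''q'' 0)"
        using q q' by (intro runs_loop_free) (auto simp: cell_prog_def)
    next
      assume "\<not> ?b"
      then have "nmem s' ''q'' 0 = W" using J L(3) by (simp add: J_def)
      then show "filled I w W (Suc i * W) s' \<and> (\<forall>k\<le>i. nmem s' ''row'' k = k * W)"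
        using J L(7) by (simp add: J_def add.commute)
    }
  qed (use h in \<open>simp_all add: cell_prog_def d_def J_def filled_def\<close>)
qed

lemma runs_table_prog:
  assumes I: "sdsp_instance I" and s: "loaded I \<epsilon> s" "prepared I s" "nmem s ''W'' 0 = W" "nmem s ''w'' = w"
  shows "runs table_prog s (10 + (num I + 1 + 1) * ((W + 2) * 100))
    (\<lambda>s'. filled I w W (Suc (num I) * W) s' \<and> (\<forall>k\<le>num I. nmem s' ''row'' k = k * W))"
proof -
  define d where "d = nset ''i'' (NConst 0) ;; nset ''b'' (NConst 0)"
  \<comment> \<open>Row 0, the empty prefix, is computed as well, so there are
    \<open>num I + 1\<close> rows and \<open>i\<close> ends one beyond the last.\<close>
  define J where "J = (\<lambda>s' :: mem. nmem s' ''i'' 0 \<le> Suc (num I) \<and> nmem s' ''b'' 0 = nmem s' ''i'' 0 * W \<and>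
     filled I w W (nmem s' ''i'' 0 * W) s' \<and> (\<forall>k<nmem s' ''i'' 0. nmem s' ''row'' k = k * W))"
  note defs = table_step_def row_prog_def cell_prog_def d_def
  have L: "loaded I \<epsilon> s'" "prepared I s'" "nmem s' ''W'' 0 = W" "nmem s' ''w'' = w"
    if A: "agree_off (writes table_step) (eff d s) s'" for s'
  proof -
    show "loaded I \<epsilon> s'"
      by (rule loaded_agree_off[OF A]) (use s(1) in \<open>simp_all add: defs loaded_def\<close>)
    show "prepared I s'"
      by (rule prepared_agree_off[OF A]) (use s(2) in \<open>simp_all add: defs prepared_def\<close>)
  qed (use s in \<open>simp_all add: agree_offD[OF A] defs\<close>)
  show ?thesis
    unfolding table_prog_def d_def[symmetric]
  proof (rule runs_init_Loop[where J = J and \<mu> = "\<lambda>s. Suc (num I) - nmem s ''i'' 0" and T = "10 + (W + 1) * 100 + 20"])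
    fix s' assume J: "J s'" and A: "agree_off (writes table_step) (eff d s) s'"
    note L = L[OF A]
    let ?b = "bval (BNot (NLess (nvar ''n'') (nvar ''i''))) s'"
    let ?i = "nmem s' ''i'' 0"
    {
      assume ?b
      then have i: "?i \<le> num I" using loadedD(1)[OF L(1)] by simp
      show "runs table_step s' (10 + (W + 1) * 100 + 20)
          (\<lambda>s''. J s'' \<and> Suc (num I) - nmem s'' ''i'' 0 < Suc (num I) - nmem s' ''i'' 0)"
        unfolding table_step_def
      proof (rule runs_Then_loop_free[OF runs_frame[OF runs_row_prog[OF I L refl i]]])
        fix s2
        assume 2: "(filled I w W (Suc ?i * W) s2 \<and> (\<forall>k\<le>?i. nmem s2 ''row'' k = k * W)) \<and>
          agree_off (writes row_prog) s' s2"
        then have A2: "agree_off (writes row_prog) s' s2" by blast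
        have "nmem s2 ''i'' = nmem s' ''i''" "nmem s2 ''b'' = nmem s' ''b''" "nmem s2 ''W'' = nmem s' ''W''"
          by (simp_all add: agree_offD[OF A2] row_prog_def cell_prog_def)
        then show "J (eff (incr ''i'' ;; nset ''b'' (NAdd (nvar ''b'') (nvar ''W''))) s2) \<and>
          Suc (num I) - nmem (eff (incr ''i'' ;; nset ''b'' (NAdd (nvar ''b'') (nvar ''W''))) s2) ''i'' 0
            < Suc (num I) - nmem s' ''i'' 0"
          using 2 J i L(3) by (auto simp: J_def filled_def less_Suc_eq_le)
      qed (use J in \<open>simp_all add: J_def\<close>)
    next
      assume "\<not> ?b"
      then have "?i = Suc (num I)" using J loadedD(1)[OF L(1)] by (simp add: J_def)
      then show "filled I w W (Suc (num I) * W) s' \<and> (\<forall>k\<le>num I. nmem s' ''row'' k = k * W)"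
        using J by (simp add: J_def less_Suc_eq_le)
    }
  qed (simp_all add: d_def J_def filled_def)
qed


text \<open>Addresses go through \<open>row\<close>, which hides the row-major arithmetic from the
  stages that only read the table.\<close>

definition table :: "sdsp \<Rightarrow> mem \<Rightarrow> bool" where
  "table I s \<longleftrightarrow> (\<forall>i\<le>num I. \<forall>q<nmem s ''W'' 0.
     rmem s ''h'' (nmem s ''row'' i + q) = mincost I (nmem s ''w'') i q)"

lemma table_agree_off:
  assumes "agree_off X s s'" "table I s" "X \<inter> {''W'', ''h'', ''row'', ''w''} = {}"
  shows "table I s'"
proof -
  have "nmem s' x = nmem s x" "rmem s' x = rmem s x" if "x \<in> {''W'', ''h'', ''row'', ''w''}" for x
    using assms(3) that agree_offD[OF assms(1)] by (metis disjoint_iff)+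
  then show ?thesis using assms(2) unfolding table_def by simp
qed

lemma table_filled:
  assumes "filled I (nmem s ''w'') W (Suc (num I) * W) s" "nmem s ''W'' 0 = W"
    "\<forall>k\<le>num I. nmem s ''row'' k = k * W"
  shows "table I s"
  unfolding table_def
proof (intro allI impI)
  fix i q assume i: "i \<le> num I" and q: "q < nmem s ''W'' 0"
  have "i * W + q < Suc i * W" using q assms(2) by simp
  also have "\<dots> \<le> Suc (num I) * W" using i by (intro mult_le_mono1) simp
  finally show "rmem s ''h'' (nmem s ''row'' i + q) = mincost I (nmem s ''w'') i q"
    using assms i q by (simp add: filled_def)
qed

section \<open>Selecting the best column and reading off a set\<close>

definition select_step :: com where
  "select_step = Cond (RLess (rvar ''B'') (RGet ''h'' (NAdd (NGet ''row'' (nvar ''n'')) (nvar ''q''))))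
       Skip (nset ''best'' (nvar ''q'')) ;; incr ''q''"

definition select_prog :: com where
  "select_prog = (nset ''q'' (NConst 0) ;; nset ''best'' (NConst 0)) ;;
     Loop (NLess (nvar ''q'') (nvar ''W'')) select_step"

text \<open>Columns are scanned in increasing order, so the last one within the budget is the
  largest.\<close>

lemma runs_select_prog:
  assumes I: "sdsp_instance I" and s: "loaded I \<epsilon> s" "table I s" "nmem s ''W'' 0 = W" "nmem s ''w'' = w"
    and W: "0 < W"
  shows "runs select_prog s (10 + (W + 1) * 50) (\<lambda>s'. nmem s' ''best'' 0 < W \<and>
     mincost I w (num I) (nmem s' ''best'' 0) \<le> budget I \<and>
     (\<forall>q<W. mincost I w (num I) q \<le> budget I \<longrightarrow> q \<le> nmem s' ''best'' 0))"
proof -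
  define d where "d = nset ''q'' (NConst 0) ;; nset ''best'' (NConst 0)"
  define J where "J = (\<lambda>s' :: mem. nmem s' ''q'' 0 \<le> W \<and> nmem s' ''best'' 0 < W \<and>
     mincost I w (num I) (nmem s' ''best'' 0) \<le> budget I \<and>
     (\<forall>q<nmem s' ''q'' 0. mincost I w (num I) q \<le> budget I \<longrightarrow> q \<le> nmem s' ''best'' 0))"
  have L: "loaded I \<epsilon> s'" "table I s'" "nmem s' ''W'' 0 = W" "nmem s' ''w'' = w"
    if A: "agree_off (writes select_step) (eff d s) s'" for s'
  proof -
    show "loaded I \<epsilon> s'"
      by (rule loaded_agree_off[OF A]) (use s(1) in \<open>simp_all add: select_step_def d_def loaded_def\<close>)
    show "table I s'"
      by (rule table_agree_off[OF A]) (use s(2) in \<open>simp_all add: select_step_def d_def table_def\<close>)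
  qed (use s in \<open>simp_all add: agree_offD[OF A] select_step_def d_def\<close>)
  \<comment> \<open>The empty set shows that column 0 is within the budget, which justifies 0 as the
    initial \<open>best\<close>.\<close>
  have "mincost I w (num I) (sum w {}) \<le> total_cost I {}"
    by (rule mincost_le[OF I]) (simp_all add: compatible_set_def)
  then have m0: "mincost I w (num I) 0 \<le> budget I"
    using I by (simp add: total_cost_def sdsp_instance_def)
  show ?thesis
    unfolding select_prog_def d_def[symmetric]
  proof (rule runs_init_Loop[where J = J and \<mu> = "\<lambda>s. W - nmem s ''q'' 0" and T = "ctime select_step"])
    fix s' assume J: "J s'" and A: "agree_off (writes select_step) (eff d s) s'"
    note L = L[OF A]
    let ?b = "bval (NLess (nvar ''q'') (nvar ''W'')) s'"
    let ?q = "nmem s' ''q'' 0"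
    {
      assume ?b
      then have q: "?q < W" using L(3) by simp
      have h: "rmem s' ''h'' (nmem s' ''row'' (num I) + ?q) = mincost I w (num I) ?q"
        using L q by (simp add: table_def)
      have "J (eff select_step s')"
        using J q h loadedD(1,3)[OF L(1)] by (auto simp: J_def select_step_def less_Suc_eq)
      then show "runs select_step s' (ctime select_step)
          (\<lambda>s''. J s'' \<and> W - nmem s'' ''q'' 0 < W - nmem s' ''q'' 0)"
        using q by (intro runs_loop_free) (auto simp: select_step_def)
    next
      assume "\<not> ?b"
      then have "?q = W" using J L(3) by (simp add: J_def)
      then show "nmem s' ''best'' 0 < W \<and> mincost I w (num I) (nmem s' ''best'' 0) \<le> budget I \<and>
          (\<forall>q<W. mincost I w (num I) q \<le> budget I \<longrightarrow> q \<le> nmem s' ''best'' 0)"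
        using J by (simp add: J_def)
    }
  qed (use m0 W in \<open>simp_all add: select_step_def d_def J_def\<close>)
qed

text \<open>\<open>best\<close> is reused for the scaled profit still to be collected.\<close>

definition trace_step :: com where
  "trace_step = Cond (RLess (RGet ''h'' (NAdd (NGet ''row'' (nvar ''i'')) (nvar ''best'')))
       (RGet ''h'' (NAdd (NGet ''row'' (NSub (nvar ''i'') (NConst 1))) (nvar ''best''))))
     (nset ''j'' (NGet ''item'' (nvar ''i'')) ;; NPut ''out'' (nvar ''j'') (NConst 1) ;;
      nset ''best'' (NSub (nvar ''best'') (NGet ''w'' (nvar ''j''))) ;;
      nset ''i'' (NGet ''pred'' (nvar ''j'')))
     (nset ''i'' (NSub (nvar ''i'') (NConst 1)))"

definition trace_prog :: com where
  "trace_prog = nset ''i'' (nvar ''n'') ;; Loop (NLess (NConst 0) (nvar ''i'')) trace_step"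

lemma runs_trace_prog:
  assumes I: "sdsp_instance I" and s: "loaded I \<epsilon> s" "prepared I s" "table I s"
      "nmem s ''w'' = w" "nmem s ''W'' 0 = W" "nmem s ''best'' 0 = q" "nmem s ''out'' = (\<lambda>_. 0)"
    and q: "q < W"
  shows "runs trace_prog s (10 + (num I + 1) * 100) (\<lambda>s'. result s' = trace I w (num I) q)"
proof -
  define d where "d = nset ''i'' (nvar ''n'')"
  \<comment> \<open>What has been output together with the trace from the current cell is always the
    full trace. The row index strictly decreases, also when \<open>pred\<close> skips rows.\<close>
  define J where "J = (\<lambda>s' :: mem. nmem s' ''i'' 0 \<le> num I \<and> nmem s' ''best'' 0 < W \<and>
     result s' \<union> trace I w (nmem s' ''i'' 0) (nmem s' ''best'' 0) = trace I w (num I) q)"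
  have L: "prepared I s'" "table I s'" "nmem s' ''W'' 0 = W" "nmem s' ''w'' = w"
    if A: "agree_off (writes trace_step) (eff d s) s'" for s'
  proof -
    show "prepared I s'"
      by (rule prepared_agree_off[OF A]) (use s(2) in \<open>simp_all add: trace_step_def d_def prepared_def\<close>)
    show "table I s'"
      by (rule table_agree_off[OF A]) (use s(3) in \<open>simp_all add: trace_step_def d_def table_def\<close>)
  qed (use s in \<open>simp_all add: agree_offD[OF A] trace_step_def d_def\<close>)
  show ?thesis
    unfolding trace_prog_def d_def[symmetric]
  proof (rule runs_init_Loop[where J = J and \<mu> = "\<lambda>s. nmem s ''i'' 0" and T = "ctime trace_step"])
    fix s' assume J: "J s'" and A: "agree_off (writes trace_step) (eff d s) s'"
    note L = L[OF A]
    let ?b = "bval (NLess (NConst 0) (nvar ''i'')) s'"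
    let ?i = "nmem s' ''i'' 0" and ?q = "nmem s' ''best'' 0"
    {
      assume ?b
      then obtain i' where i': "?i = Suc i'" by (cases ?i) auto
      define j where "j = item I (Suc i')"
      have i1: "Suc i' \<in> {1..num I}" using J i' by (simp add: J_def)
      have j: "j \<in> {1..num I}" "rank I j = Suc i'" using item_in[OF i1] rank_item[OF i1] by (auto simp: j_def)
      have np: "npred I j \<le> i'"
        using npred_less[of j I] j I by (auto simp: sdsp_instance_def)
      have m: "nmem s' ''item'' (Suc i') = j" "nmem s' ''pred'' j = npred I j"
        using L(1) j i1 by (auto simp: prepared_def j_def)
      have q: "?q < W" using J by (simp add: J_def)
      have h: "rmem s' ''h'' (nmem s' ''row'' (Suc i') + ?q) = mincost I w (Suc i') ?q"
          "rmem s' ''h'' (nmem s' ''row'' i' + ?q) = mincost I w i' ?q"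
        using L q i1 by (simp_all add: table_def)
      have T: "trace I w (Suc i') ?q = (if mincost I w (Suc i') ?q < mincost I w i' ?q
          then insert j (trace I w (npred I j) (?q - w j)) else trace I w i' ?q)"
        using np j_def by (simp add: trace.simps(2) Let_def min_absorb2)
      have R: "result (nput ''i'' x v t) = result t" "result (nput ''best'' x v t) = result t"
          "result (nput ''j'' x v t) = result t" "result (nput ''out'' x 1 t) = insert x (result t)"
        for x v t by (auto simp: result_def)
      have "J (eff trace_step s') \<and> nmem (eff trace_step s') ''i'' 0 < ?i"
      proof (cases "mincost I w (Suc i') ?q < mincost I w i' ?q")
        case True
        let ?s2 = "nput ''i'' 0 (npred I j) (nput ''best'' 0 (?q - w j) (nput ''out'' j 1 (nput ''j'' 0 j s')))"
        have "eff trace_step s' = ?s2"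
          using True i' h m L(4) by (simp add: trace_step_def)
        moreover have "result ?s2 = insert j (result s')"
          by (simp only: R)
        ultimately show ?thesis using J i' np True T i1 by (auto simp: J_def)
      next
        case False
        then have "eff trace_step s' = nput ''i'' 0 i' s'"
          using i' h by (simp add: trace_step_def)
        then show ?thesis using J i' False T by (auto simp: J_def R)
      qed
      then show "runs trace_step s' (ctime trace_step)
          (\<lambda>s''. J s'' \<and> nmem s'' ''i'' 0 < nmem s' ''i'' 0)"
        by (intro runs_loop_free) (simp_all add: trace_step_def)
    next
      assume "\<not> ?b"
      then show "result s' = trace I w (num I) q" using J by (simp add: J_def)
    }
  qed (use s q loadedD(1)[OF s(1)] in \<open>simp_all add: trace_step_def d_def J_def result_def\<close>)
qed

section \<open>Composition of the stages and the running time\<close>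

definition sdsp_fptas :: com where
  "sdsp_fptas = Cond (RLess (rvar ''eps'') (RConst 1))
     (max_prog ;; count_prog ;; prep_prog ;; table_prog ;; select_prog ;; trace_prog) Skip"

text \<open>If \<open>n \<ge> 1\<close>, then also \<open>F \<ge> 1\<close>, so every lower-order
  term is bounded by \<open>n * n * F\<close>; the coefficients add up to less than 5000. If
  \<open>n = 0\<close>, only a constant remains, which the maximum with 1 absorbs.\<close>

lemma fptas_time:
  fixes n N F :: nat
  assumes "n \<le> F" "N \<le> F + 1" "n = 0 \<Longrightarrow> F = 0"
  shows "(10 + (n + 1) * 50) + ((10 + (F + 1 + 1) * 50) + ((10 + (n + 1) * ((N + n + 2) * 100)) +
     ((10 + (n + 1 + 1) * ((1 + n * N + 2) * 100)) +
      ((10 + (1 + n * N + 1) * 50) + (10 + (n + 1) * 100)))))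
     \<le> 5000 * max 1 (n * n * F)" (is "?l N \<le> _")
proof (cases "n = 0")
  case True
  then show ?thesis using assms by simp
next
  case False
  define X where "X = n * n * F"
  have n: "1 \<le> n" "1 \<le> F" using False assms(1) by auto
  have X: "n * F \<le> X" "n * n \<le> X" "F \<le> X" "n \<le> X" "1 \<le> X"
  proof -
    show 1: "n * F \<le> X" and 2: "n * n \<le> X" using n by (simp_all add: X_def)
    show "F \<le> X" "n \<le> X" "1 \<le> X"
      using 1 n mult_le_mono1[OF n(1), of F] mult_le_mono2[OF n(2), of n] by linarith+
  qed
  have "?l N \<le> ?l (F + 1)"
    using assms(2) by (intro add_mono mult_le_mono order_refl) simp_all
  also have "\<dots> = 1310 + 150 * F + 1100 * n + 350 * (n * F) + 200 * (n * n) + 100 * X"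
    by (simp add: X_def algebra_simps)
  also have "\<dots> \<le> 5000 * X" using X by linarith
  finally show ?thesis unfolding X_def by linarith
qed

lemma runs_sdsp_fptas:
  assumes I: "sdsp_instance I" and \<epsilon>: "0 < \<epsilon>" "\<epsilon> < 1"
    and F: "F = nat \<lfloor>real (num I) / \<epsilon>\<rfloor>"
  shows "runs sdsp_fptas (input I \<epsilon>) (10 + 5000 * max 1 (num I * num I * F))
    (\<lambda>s. feasible I (result s) \<and> (1 - \<epsilon>) * opt I \<le> total_profit I (result s))"
    (is "runs _ _ _ ?Q")
proof -
  define n where "n = num I"
  define Mok where "Mok = (\<lambda>s :: mem. 0 \<le> rmem s ''M'' 0 \<and> rmem s ''M'' 0 \<le> opt I \<and>
    (\<forall>j\<in>{1..num I}. cost I j \<le> budget I \<longrightarrow> profit I j \<le> rmem s ''M'' 0))"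
  define P0 where "P0 = (\<lambda>s. loaded I \<epsilon> s \<and> nmem s ''out'' = (\<lambda>_. 0))"
  define P1 where "P1 = (\<lambda>s. P0 s \<and> Mok s \<and> rmem s ''rn'' 0 = real (num I))"
  define P2 where "P2 = (\<lambda>N s. P0 s \<and> Mok s \<and> nmem s ''N'' 0 = N)"
  define P3 where "P3 = (\<lambda>N s. P2 N s \<and> prepared I s)"
  define P4 where "P4 = (\<lambda>N s. P3 N s \<and> table I s)"
  define P5 where "P5 = (\<lambda>N s. P4 N s \<and> (let w = nmem s ''w''; q = nmem s ''best'' 0 in
     q < 1 + num I * N \<and> mincost I w (num I) q \<le> budget I \<and>
     (\<forall>q'<1 + num I * N. mincost I w (num I) q' \<le> budget I \<longrightarrow> q' \<le> q)))"
  \<comment> \<open>The number \<open>N\<close> becomes known only after counting, so the later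
    predicates take it as a parameter and it is passed on existentially.\<close>
  define Nok where "Nok = (\<lambda>N. real (num I) < \<epsilon> * real N \<and> N \<le> F + 1)"
  have P0: "P0 s'" if "P0 s" "agree_off X s s'"
    "X \<inter> {''n'', ''eps'', ''B'', ''tL'', ''tR'', ''c'', ''p'', ''out''} = {}" for X s s'
    using that loaded_agree_off[OF that(2)] agree_offD(1)[OF that(2), of "''out''"]
    by (auto simp: P0_def)
  have 1: "runs max_prog (input I \<epsilon>) (10 + (n + 1) * 50) P1"
  proof (rule runs_mono[OF runs_frame[OF runs_max_prog[OF I loaded_input]]])
    fix s' assume *: "(rmem s' ''rn'' 0 = real (num I) \<and> 0 \<le> rmem s' ''M'' 0 \<and> rmem s' ''M'' 0 \<le> opt I \<and>
      (\<forall>j\<in>{1..num I}. cost I j \<le> budget I \<longrightarrow> profit I j \<le> rmem s' ''M'' 0)) \<and>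
      agree_off (writes max_prog) (input I \<epsilon>) s'"
    have "P0 (input I \<epsilon>)" by (simp add: P0_def loaded_input) (simp add: input_def Let_def)
    then have "P0 s'" by (rule P0[OF _ conjunct2[OF *]]) (simp add: max_prog_def max_step_def)
    then show "P1 s'" using * by (simp add: P1_def Mok_def)
  qed (simp add: n_def)
  have 2: "runs count_prog s (10 + (F + 1 + 1) * 50) (\<lambda>s'. \<exists>N. Nok N \<and> P2 N s')" if s: "P1 s" for s
  proof (rule runs_mono[OF runs_frame[OF runs_count_prog[OF _ _ \<epsilon>(1) F]]])
    fix s' assume *: "(real (num I) < \<epsilon> * real (nmem s' ''N'' 0) \<and> nmem s' ''N'' 0 \<le> F + 1) \<and>
      agree_off (writes count_prog) s s'"
    then have A: "agree_off (writes count_prog) s s'" by blast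
    have "P0 s'" by (rule P0[OF _ A]) (use s in \<open>simp_all add: P1_def count_prog_def count_step_def\<close>)
    moreover have "rmem s' ''M'' = rmem s ''M''"
      by (simp add: agree_offD[OF A] count_prog_def count_step_def)
    ultimately show "\<exists>N. Nok N \<and> P2 N s'" using * s by (simp add: P1_def P2_def Mok_def Nok_def)
  qed (use s in \<open>simp_all add: P1_def P0_def\<close>)
  have 3: "runs prep_prog s (10 + (n + 1) * ((N + n + 2) * 100)) (P3 N)" if s: "P2 N s" for s N
  proof (rule runs_mono[OF runs_frame[OF runs_prep_prog[OF I _ refl refl, of \<epsilon>]]])
    fix s' assume *: "prepared I s' \<and> agree_off (writes prep_prog) s s'"
    then have A: "agree_off (writes prep_prog) s s'" by blast
    note defs = prep_prog_def prep_step_def scale_prog_def scale_step_def rank_prog_def rank_step_def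
    have "P0 s'" by (rule P0[OF _ A]) (use s in \<open>simp_all add: P2_def defs\<close>)
    moreover have "rmem s' ''M'' = rmem s ''M''" "nmem s' ''N'' = nmem s ''N''"
      by (simp_all add: agree_offD[OF A] defs)
    ultimately show "P3 N s'" using * s by (simp add: P3_def P2_def Mok_def)
  qed (use s in \<open>simp_all add: P2_def P0_def Mok_def n_def\<close>)
  have 4: "runs table_prog s (10 + (n + 1 + 1) * ((1 + n * N + 2) * 100)) (P4 N)" if s: "P3 N s" for s N
  proof (rule runs_mono[OF runs_frame[OF runs_table_prog[OF I, of \<epsilon>]]])
    show "nmem s ''W'' 0 = 1 + n * N" using s by (simp add: P3_def P2_def prepared_def n_def)
    fix s' assume *: "(filled I (nmem s ''w'') (1 + n * N) (Suc (num I) * (1 + n * N)) s' \<and>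
      (\<forall>k\<le>num I. nmem s' ''row'' k = k * (1 + n * N))) \<and> agree_off (writes table_prog) s s'"
    then have A: "agree_off (writes table_prog) s s'" by blast
    note defs = table_prog_def table_step_def row_prog_def cell_prog_def
    have "P0 s'" by (rule P0[OF _ A]) (use s in \<open>simp_all add: P3_def P2_def defs\<close>)
    moreover have fr: "rmem s' ''M'' = rmem s ''M''" "nmem s' ''N'' = nmem s ''N''"
        "nmem s' ''W'' = nmem s ''W''" "nmem s' ''w'' = nmem s ''w''"
      by (simp_all add: agree_offD[OF A] defs)
    moreover have "prepared I s'"
      by (rule prepared_agree_off[OF A]) (use s in \<open>simp_all add: P3_def defs\<close>)
    moreover have "table I s'"
      by (rule table_filled[where W = "1 + n * N"])
        (use * s fr in \<open>simp_all add: P3_def P2_def prepared_def n_def\<close>)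
    ultimately show "P4 N s'" using s by (simp add: P4_def P3_def P2_def Mok_def)
  qed (use s in \<open>simp_all add: P3_def P2_def P0_def n_def\<close>)
  have 5: "runs select_prog s (10 + (1 + n * N + 1) * 50) (P5 N)" if s: "P4 N s" for s N
  proof (rule runs_mono[OF runs_frame[OF runs_select_prog[OF I, of \<epsilon>]]])
    show "nmem s ''W'' 0 = 1 + n * N" using s by (simp add: P4_def P3_def P2_def prepared_def n_def)
    fix s' assume *: "(nmem s' ''best'' 0 < 1 + n * N \<and>
        mincost I (nmem s ''w'') (num I) (nmem s' ''best'' 0) \<le> budget I \<and>
        (\<forall>q<1 + n * N. mincost I (nmem s ''w'') (num I) q \<le> budget I \<longrightarrow> q \<le> nmem s' ''best'' 0)) \<and>
      agree_off (writes select_prog) s s'"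
    then have A: "agree_off (writes select_prog) s s'" by blast
    note defs = select_prog_def select_step_def
    have "P0 s'" by (rule P0[OF _ A]) (use s in \<open>simp_all add: P4_def P3_def P2_def defs\<close>)
    moreover have fr: "rmem s' ''M'' = rmem s ''M''" "nmem s' ''N'' = nmem s ''N''"
        "nmem s' ''w'' = nmem s ''w''"
      by (simp_all add: agree_offD[OF A] defs)
    moreover have "prepared I s'"
      by (rule prepared_agree_off[OF A]) (use s in \<open>simp_all add: P4_def P3_def defs\<close>)
    moreover have "table I s'"
      by (rule table_agree_off[OF A]) (use s in \<open>simp_all add: P4_def defs\<close>)
    ultimately show "P5 N s'" using s * by (simp add: P5_def P4_def P3_def P2_def Mok_def n_def Let_def)
  qed (use s in \<open>simp_all add: P4_def P3_def P2_def P0_def n_def\<close>)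
  have 6: "runs trace_prog s (10 + (n + 1) * 100) ?Q" if s: "P5 N s" and N: "Nok N" for s N
  proof (rule runs_mono[OF runs_trace_prog[OF I, where \<epsilon> = \<epsilon> and W = "1 + n * N" and
        w = "nmem s ''w''" and q = "nmem s ''best'' 0"]])
    let ?w = "nmem s ''w''" and ?q = "nmem s ''best'' 0"
    fix s' assume *: "result s' = trace I ?w (num I) ?q"
    \<comment> \<open>With \<open>N = 0\<close> the strict inequality
      \<open>num I < \<epsilon> * N\<close> would fail.\<close>
    have N0: "0 < N" using N \<epsilon> by (cases N) (auto simp: Nok_def)
    show "?Q s'"
      unfolding *
      by (intro conjI trace_approx[OF I, of \<epsilon> N "rmem s ''M'' 0"])
        (use s N N0 in \<open>auto simp: P5_def P4_def P3_def P2_def Mok_def Nok_def prepared_def Let_def less_Suc_eq_le\<close>)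
  qed (use s in \<open>auto simp: P5_def P4_def P3_def P2_def P0_def prepared_def n_def Let_def\<close>)
  have nF: "n \<le> F"
  proof -
    have "real n \<le> real n / \<epsilon>" using \<epsilon> by (simp add: field_simps mult_left_le_one_le)
    then show ?thesis unfolding F n_def by (simp add: le_nat_floor)
  qed
  have F0: "n = 0 \<Longrightarrow> F = 0" by (simp add: F n_def)
  let ?T = "5000 * max 1 (n * n * F)"
  \<comment> \<open>Replacing \<open>N\<close> by its bound \<open>F + 1\<close> makes the time
    independent of the existential witness.\<close>
  have rest: "runs (prep_prog ;; table_prog ;; select_prog ;; trace_prog) s
      ((10 + (n + 1) * ((F + 1 + n + 2) * 100)) + ((10 + (n + 1 + 1) * ((1 + n * (F + 1) + 2) * 100)) +
      ((10 + (1 + n * (F + 1) + 1) * 50) + (10 + (n + 1) * 100)))) ?Q"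
    if ex: "\<exists>N. Nok N \<and> P2 N s" for s
  proof -
    obtain N where N: "Nok N" "P2 N s" using ex by blast
    have "N \<le> F + 1" using N by (simp add: Nok_def)
    then show ?thesis
      by (intro runs_mono[OF runs_Then[OF 3[OF N(2)] runs_Then[OF 4 runs_Then[OF 5 6[OF _ N(1)]]]]]
          add_mono mult_le_mono order_refl) simp_all
  qed
  have main: "runs (max_prog ;; count_prog ;; prep_prog ;; table_prog ;; select_prog ;; trace_prog)
      (input I \<epsilon>) ?T ?Q"
    by (rule runs_mono[OF runs_Then[OF 1 runs_Then[OF 2 rest]] fptas_time[OF nF order_refl F0]])
  have "bval (RLess (rvar ''eps'') (RConst 1)) (input I \<epsilon>)"
    using loadedD(2)[OF loaded_input] \<epsilon> by simp
  from exec.CondTrue[OF this] main show ?thesis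
    unfolding sdsp_fptas_def runs_def n_def by fastforce
qed

text \<open>One program and one constant serve all instances and all accuracies. The maximum with 1
  allows for constant time when the floor is 0, as it is without deliveries or when \<epsilon>
  exceeds their number.\<close>

theorem theorem2:
  shows "\<exists>(prog :: com) (C :: real). \<forall>(I :: sdsp) (\<epsilon> :: real). sdsp_instance I \<and> \<epsilon> > 0 \<longrightarrow>
    (\<exists>t s. exec prog (input I \<epsilon>) t s \<and>
       feasible I (result s) \<and>
       total_profit I (result s) \<ge> (1 - \<epsilon>) * opt I \<and>
       real t \<le> C * max 1 (real (num I) ^ 2 * of_int \<lfloor>real (num I) / \<epsilon>\<rfloor>))"
proof (rule exI[of _ sdsp_fptas], rule exI[of _ "5010 :: real"], intro allI impI)
  fix I :: sdsp and \<epsilon> :: real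
  assume "sdsp_instance I \<and> \<epsilon> > 0"
  then have I: "sdsp_instance I" and \<epsilon>: "\<epsilon> > 0" by auto
  define F where "F = nat \<lfloor>real (num I) / \<epsilon>\<rfloor>"
  have F: "real_of_int \<lfloor>real (num I) / \<epsilon>\<rfloor> = real F" using \<epsilon> by (simp add: F_def)
  have "runs sdsp_fptas (input I \<epsilon>) (10 + 5000 * max 1 (num I * num I * F))
    (\<lambda>s. feasible I (result s) \<and> (1 - \<epsilon>) * opt I \<le> total_profit I (result s))"
  proof (cases "\<epsilon> < 1")
    case True
    show ?thesis by (rule runs_sdsp_fptas[OF I \<epsilon> True F_def])
  next
    case False
    have "result (input I \<epsilon>) = {}" by (simp add: result_def input_def Let_def)
    \<comment> \<open>For \<epsilon> at least 1 the guarantee is a nonpositive number, which the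
      empty set meets.\<close>
    moreover have "(1 - \<epsilon>) * opt I \<le> 0"
      using False opt_nonneg[OF I] by (simp add: mult_nonpos_nonneg)
    moreover have "exec sdsp_fptas (input I \<epsilon>) (1 + btime (RLess (rvar ''eps'') (RConst 1)) + 1) (input I \<epsilon>)"
      unfolding sdsp_fptas_def using False loadedD(2)[OF loaded_input]
      by (intro exec.CondFalse exec.Skip) simp
    ultimately show ?thesis
      using feasible_empty[OF I] unfolding runs_def
      by (intro exI conjI) (auto simp: total_profit_def)
  qed
  then obtain t s where *: "exec sdsp_fptas (input I \<epsilon>) t s" "t \<le> 10 + 5000 * max 1 (num I * num I * F)"
      "feasible I (result s)" "(1 - \<epsilon>) * opt I \<le> total_profit I (result s)"
    by (auto simp: runs_def)
  \<comment> \<open>The additive 10 is absorbed because the maximum is at least 1.\<close>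
  have "t \<le> 5010 * max 1 (num I * num I * F)" using *(2) by linarith
  then have "real t \<le> real (5010 * max 1 (num I * num I * F))" by (rule of_nat_mono)
  also have "\<dots> = 5010 * max 1 (real (num I) ^ 2 * of_int \<lfloor>real (num I) / \<epsilon>\<rfloor>)"
    by (simp add: F of_nat_max power2_eq_square)
  finally show "\<exists>t s. exec sdsp_fptas (input I \<epsilon>) t s \<and> feasible I (result s) \<and>
      total_profit I (result s) \<ge> (1 - \<epsilon>) * opt I \<and>
      real t \<le> 5010 * max 1 (real (num I) ^ 2 * of_int \<lfloor>real (num I) / \<epsilon>\<rfloor>)"
    using * by blast
qed

end
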